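(* Let $(R,\mathfrak m)$ be a commutative noetherian local ring, $I$ an ideal of $R$, $\overline I=\operatorname{Ann}_R(\operatorname{Ann}_R(I))$, and let $M$ be an $R$-module. (a) If $M$ is injective, then $IM=\gamma(M)=M[\operatorname{Ann}_R(I)]$ and $M[\overline I]\subset\kappa(M)\subset M[I]$. (b) If $M$ is flat, then $\operatorname{Ann}_R(I)\cdot M=\kappa(M)=M[I]$ and $IM\subset\gamma(M)\subset\overline I M$.
   Context: $E$ is the injective hull of the residue field $R/\mathfrak m$, and $I^\circ=\operatorname{Hom}_R(I,E)$. $\mathcal P$ is the class of all $I$-generated $R$-modules $M$ (there is an epimorphism $I^{(\Lambda)}\twoheadrightarrow M$ from a direct sum of copies of $I$), and $\mathcal S$ is the class of all $I^\circ$-cogenerated $R$-modules $N$ (there is a monomorphism $N\hookrightarrow(I^\circ)^\Lambda$ into a direct product of copies of $I^\circ$). For an $R$-module $M$, $\gamma(M)=\sum\{U\subset M\mid U\in\mathcal P\}$ is the largest submodule of $M$ belonging to $\mathcal P$, and $\kappa(M)=\bigcap\{V\subset M\mid M/V\in\mathcal S\}$ is the smallest submodule $V$ of $M$ with $M/V\in\mathcal S$. For an ideal $\mathfrak a$ of $R$, $M[\mathfrak a]=\{x\in M\mid ax=0\text{ for all }a\in\mathfrak a\}$. *)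

theory Defs
  imports "HOL-Algebra.Algebra"
begin

section \<open>Rings and ideals\<close>

definition local_ring :: "('a, 'r) ring_scheme \<Rightarrow> 'a set \<Rightarrow> bool" where
  "local_ring R \<mm> \<longleftrightarrow> cring R \<and> maximalideal \<mm> R \<and> (\<forall>J. maximalideal J R \<longrightarrow> J = \<mm>)"

definition Ann :: "('a, 'r) ring_scheme \<Rightarrow> 'a set \<Rightarrow> 'a set" where
  "Ann R I = {r \<in> carrier R. \<forall>a\<in>I. r \<otimes>\<^bsub>R\<^esub> a = \<zero>\<^bsub>R\<^esub>}"


section \<open>Modules\<close>

text \<open>The record type of modules extends the one of rings; the locale \<^locale>\<open>module\<close> never
  mentions the fields \<^const>\<open>monoid.mult\<close> and \<^const>\<open>one\<close>, which are left undefined in the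
  modules built below.  Modules of functions have extensional functions as elements.  A submodule
  \<open>U\<close> of \<open>M\<close> is the module \<open>M\<lparr>carrier := U\<rparr>\<close>.\<close>

definition regular_module :: "('a, 'r) ring_scheme \<Rightarrow> ('a, 'a) module" where
  "regular_module R =
     \<lparr>carrier = carrier R, monoid.mult = undefined, one = undefined,
      ring.zero = \<zero>\<^bsub>R\<^esub>, ring.add = (\<oplus>\<^bsub>R\<^esub>), smult = (\<otimes>\<^bsub>R\<^esub>)\<rparr>"

definition ideal_module :: "('a, 'r) ring_scheme \<Rightarrow> 'a set \<Rightarrow> ('a, 'a) module" where
  "ideal_module R I = (regular_module R)\<lparr>carrier := I\<rparr>"

definition module_hom ::
  "('a, 'r) ring_scheme \<Rightarrow> ('a, 'm, 'y) module_scheme \<Rightarrow> ('a, 'n, 'z) module_scheme \<Rightarrow> ('m \<Rightarrow> 'n) set"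
  where
  "module_hom R M N = {h \<in> carrier M \<rightarrow> carrier N.
     (\<forall>x\<in>carrier M. \<forall>y\<in>carrier M. h (x \<oplus>\<^bsub>M\<^esub> y) = h x \<oplus>\<^bsub>N\<^esub> h y) \<and>
     (\<forall>a\<in>carrier R. \<forall>x\<in>carrier M. h (a \<odot>\<^bsub>M\<^esub> x) = a \<odot>\<^bsub>N\<^esub> h x)}"

definition Hom_module ::
  "('a, 'r) ring_scheme \<Rightarrow> ('a, 'm, 'y) module_scheme \<Rightarrow> ('a, 'n, 'z) module_scheme
    \<Rightarrow> ('a, 'm \<Rightarrow> 'n) module"
  where
  "Hom_module R M N =
     \<lparr>carrier = module_hom R M N \<inter> extensional (carrier M),
      monoid.mult = undefined, one = undefined,
      ring.zero = (\<lambda>x\<in>carrier M. \<zero>\<^bsub>N\<^esub>),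
      ring.add = (\<lambda>f g. \<lambda>x\<in>carrier M. f x \<oplus>\<^bsub>N\<^esub> g x),
      smult = (\<lambda>a f. \<lambda>x\<in>carrier M. a \<odot>\<^bsub>N\<^esub> f x)\<rparr>"

definition power_module :: "'l set \<Rightarrow> ('a, 'm, 'y) module_scheme \<Rightarrow> ('a, 'l \<Rightarrow> 'm) module" where
  "power_module \<Lambda> M =
     \<lparr>carrier = (\<Lambda> \<rightarrow>\<^sub>E carrier M),
      monoid.mult = undefined, one = undefined,
      ring.zero = (\<lambda>l\<in>\<Lambda>. \<zero>\<^bsub>M\<^esub>),
      ring.add = (\<lambda>f g. \<lambda>l\<in>\<Lambda>. f l \<oplus>\<^bsub>M\<^esub> g l),
      smult = (\<lambda>a f. \<lambda>l\<in>\<Lambda>. a \<odot>\<^bsub>M\<^esub> f l)\<rparr>"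

definition copower_module :: "'l set \<Rightarrow> ('a, 'm, 'y) module_scheme \<Rightarrow> ('a, 'l \<Rightarrow> 'm) module" where
  "copower_module \<Lambda> M =
     (power_module \<Lambda> M)\<lparr>carrier := {f \<in> \<Lambda> \<rightarrow>\<^sub>E carrier M. finite {l \<in> \<Lambda>. f l \<noteq> \<zero>\<^bsub>M\<^esub>}}\<rparr>"

definition quotient_module :: "('a, 'm, 'y) module_scheme \<Rightarrow> 'm set \<Rightarrow> ('a, 'm set) module" where
  "quotient_module M V =
     \<lparr>carrier = a_rcosets\<^bsub>M\<^esub> V, monoid.mult = undefined, one = undefined,
      ring.zero = V, ring.add = (<+>\<^bsub>M\<^esub>),
      smult = (\<lambda>a C. \<Union>x\<in>C. V +>\<^bsub>M\<^esub> (a \<odot>\<^bsub>M\<^esub> x))\<rparr>"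

definition generated_submodule ::
  "('a, 'r) ring_scheme \<Rightarrow> ('a, 'm, 'y) module_scheme \<Rightarrow> 'm set \<Rightarrow> 'm set" where
  "generated_submodule R M S = \<Inter>{U. submodule U R M \<and> S \<subseteq> U}"

definition ideal_times ::
  "('a, 'r) ring_scheme \<Rightarrow> 'a set \<Rightarrow> ('a, 'm, 'y) module_scheme \<Rightarrow> 'm set" where
  "ideal_times R I M = generated_submodule R M {a \<odot>\<^bsub>M\<^esub> x | a x. a \<in> I \<and> x \<in> carrier M}"

definition torsion :: "('a, 'm, 'y) module_scheme \<Rightarrow> 'a set \<Rightarrow> 'm set" where
  "torsion M I = {x \<in> carrier M. \<forall>a\<in>I. a \<odot>\<^bsub>M\<^esub> x = \<zero>\<^bsub>M\<^esub>}"


section \<open>Tensor products and flat modules\<close>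

definition unit_vector :: "('a, 'r) ring_scheme \<Rightarrow> 's set \<Rightarrow> 's \<Rightarrow> 's \<Rightarrow> 'a" where
  "unit_vector R S s = (\<lambda>t\<in>S. if t = s then \<one>\<^bsub>R\<^esub> else \<zero>\<^bsub>R\<^esub>)"

text \<open>The tensor product is the free module on the pairs of elements, divided by the submodule
  generated by the bilinearity relations.\<close>

definition tensor_free ::
  "('a, 'r) ring_scheme \<Rightarrow> ('a, 'm, 'y) module_scheme \<Rightarrow> ('a, 'n, 'z) module_scheme
    \<Rightarrow> ('a, 'm \<times> 'n \<Rightarrow> 'a) module"
  where
  "tensor_free R M N = copower_module (carrier M \<times> carrier N) (regular_module R)"

definition tensor_relations ::
  "('a, 'r) ring_scheme \<Rightarrow> ('a, 'm, 'y) module_scheme \<Rightarrow> ('a, 'n, 'z) module_scheme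
    \<Rightarrow> ('m \<times> 'n \<Rightarrow> 'a) set"
  where
  "tensor_relations R M N =
     (let F = tensor_free R M N;
          e = (\<lambda>x y. unit_vector R (carrier M \<times> carrier N) (x, y))
      in generated_submodule R F
        ({e (x \<oplus>\<^bsub>M\<^esub> x') y \<ominus>\<^bsub>F\<^esub> (e x y \<oplus>\<^bsub>F\<^esub> e x' y) | x x' y.
            x \<in> carrier M \<and> x' \<in> carrier M \<and> y \<in> carrier N} \<union>
         {e x (y \<oplus>\<^bsub>N\<^esub> y') \<ominus>\<^bsub>F\<^esub> (e x y \<oplus>\<^bsub>F\<^esub> e x y') | x y y'.
            x \<in> carrier M \<and> y \<in> carrier N \<and> y' \<in> carrier N} \<union>
         {e (a \<odot>\<^bsub>M\<^esub> x) y \<ominus>\<^bsub>F\<^esub> (a \<odot>\<^bsub>F\<^esub> e x y) | a x y.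
            a \<in> carrier R \<and> x \<in> carrier M \<and> y \<in> carrier N} \<union>
         {e x (a \<odot>\<^bsub>N\<^esub> y) \<ominus>\<^bsub>F\<^esub> (a \<odot>\<^bsub>F\<^esub> e x y) | a x y.
            a \<in> carrier R \<and> x \<in> carrier M \<and> y \<in> carrier N}))"

definition tensor_module ::
  "('a, 'r) ring_scheme \<Rightarrow> ('a, 'm, 'y) module_scheme \<Rightarrow> ('a, 'n, 'z) module_scheme
    \<Rightarrow> ('a, ('m \<times> 'n \<Rightarrow> 'a) set) module"
  where
  "tensor_module R M N = quotient_module (tensor_free R M N) (tensor_relations R M N)"

definition pure_tensor ::
  "('a, 'r) ring_scheme \<Rightarrow> ('a, 'm, 'y) module_scheme \<Rightarrow> ('a, 'n, 'z) module_scheme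
    \<Rightarrow> 'm \<Rightarrow> 'n \<Rightarrow> ('m \<times> 'n \<Rightarrow> 'a) set"
  where
  "pure_tensor R M N x y =
     tensor_relations R M N +>\<^bsub>tensor_free R M N\<^esub> unit_vector R (carrier M \<times> carrier N) (x, y)"

text \<open>HOL cannot quantify over the types of the test modules \<open>A\<close> and \<open>B\<close> in the definitions of flat
  and of injective modules, so they range over all modules with elements in \<^typ>\<open>nat \<Rightarrow> 'a\<close>, where
  \<^typ>\<open>'a\<close> is the type of the ring elements.  This type contains a copy of every countably generated
  module (pick representatives in a free module of countable rank), in particular of the regular
  module and its ideals.  By Baer's criterion and by the ideal criterion for flatness, enlarging
  the type of the test modules does not change the notions; as assumptions, the versions below are
  in any case implied by those for arbitrary test modules.

  In the definition of flatness, \<open>g\<close> is the homomorphism induced by \<open>f\<close>; it exists for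
  every \<open>f\<close>, and it is unique on the carrier because the pure tensors generate the tensor product.\<close>

definition flat_module :: "('a, 'r) ring_scheme \<Rightarrow> ('a, 'm, 'y) module_scheme \<Rightarrow> bool" where
  "flat_module R M \<longleftrightarrow> module R M \<and>
     (\<forall>(A :: ('a, nat \<Rightarrow> 'a) module) (B :: ('a, nat \<Rightarrow> 'a) module). \<forall>f \<in> module_hom R A B.
        module R A \<and> module R B \<and> inj_on f (carrier A) \<longrightarrow>
        (\<exists>g \<in> module_hom R (tensor_module R A M) (tensor_module R B M).
           (\<forall>x\<in>carrier A. \<forall>y\<in>carrier M. g (pure_tensor R A M x y) = pure_tensor R B M (f x) y) \<and>
           inj_on g (carrier (tensor_module R A M))))"


section \<open>Injective modules and injective hulls\<close>

definition injective_module :: "('a, 'r) ring_scheme \<Rightarrow> ('a, 'm, 'y) module_scheme \<Rightarrow> bool" where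
  "injective_module R M \<longleftrightarrow> module R M \<and>
     (\<forall>(A :: ('a, nat \<Rightarrow> 'a) module) (B :: ('a, nat \<Rightarrow> 'a) module).
        \<forall>f \<in> module_hom R A B. \<forall>g \<in> module_hom R A M.
        module R A \<and> module R B \<and> inj_on f (carrier A) \<longrightarrow>
        (\<exists>h \<in> module_hom R B M. \<forall>x\<in>carrier A. h (f x) = g x))"

definition essential_mono ::
  "('a, 'r) ring_scheme \<Rightarrow> ('a, 'm, 'y) module_scheme \<Rightarrow> ('a, 'n, 'z) module_scheme
    \<Rightarrow> ('m \<Rightarrow> 'n) \<Rightarrow> bool"
  where
  "essential_mono R M N i \<longleftrightarrow> i \<in> module_hom R M N \<and> inj_on i (carrier M) \<and>
     (\<forall>U. submodule U R N \<and> U \<inter> i ` carrier M = {\<zero>\<^bsub>N\<^esub>} \<longrightarrow> U = {\<zero>\<^bsub>N\<^esub>})"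

definition injective_hull ::
  "('a, 'r) ring_scheme \<Rightarrow> ('a, 'm, 'y) module_scheme \<Rightarrow> ('a, 'n, 'z) module_scheme \<Rightarrow> bool" where
  "injective_hull R M N \<longleftrightarrow> injective_module R N \<and> (\<exists>i. essential_mono R M N i)"

definition residue_field_module :: "('a, 'r) ring_scheme \<Rightarrow> 'a set \<Rightarrow> ('a, 'a set) module" where
  "residue_field_module R \<mm> = quotient_module (regular_module R) \<mm>"


section \<open>Generated and cogenerated modules\<close>

text \<open>The index sets are sets of functions between the modules at hand.  This is no restriction:
  if there is an epimorphism from a direct sum of copies of \<open>G\<close> onto \<open>M\<close>, then the homomorphisms
  from \<open>G\<close> to \<open>M\<close> (extended by \<^const>\<open>undefined\<close>) can be used as the index set, and dually for
  monomorphisms into products.\<close>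

definition generated_by ::
  "('a, 'r) ring_scheme \<Rightarrow> ('a, 'g, 'y) module_scheme \<Rightarrow> ('a, 'm, 'z) module_scheme \<Rightarrow> bool" where
  "generated_by R G M \<longleftrightarrow> module R M \<and>
     (\<exists>(\<Lambda> :: ('g \<Rightarrow> 'm) set). \<exists>p \<in> module_hom R (copower_module \<Lambda> G) M.
        p ` carrier (copower_module \<Lambda> G) = carrier M)"

definition cogenerated_by ::
  "('a, 'r) ring_scheme \<Rightarrow> ('a, 'g, 'y) module_scheme \<Rightarrow> ('a, 'n, 'z) module_scheme \<Rightarrow> bool" where
  "cogenerated_by R G N \<longleftrightarrow> module R N \<and>
     (\<exists>(\<Lambda> :: ('n \<Rightarrow> 'g) set). \<exists>j \<in> module_hom R N (power_module \<Lambda> G). inj_on j (carrier N))"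

definition gamma ::
  "('a, 'r) ring_scheme \<Rightarrow> 'a set \<Rightarrow> ('a, 'm, 'y) module_scheme \<Rightarrow> 'm set" where
  "gamma R I M = generated_submodule R M
     (\<Union>{U. submodule U R M \<and> generated_by R (ideal_module R I) (M\<lparr>carrier := U\<rparr>)})"

definition kappa ::
  "('a, 'r) ring_scheme \<Rightarrow> ('a, 'e, 'z) module_scheme \<Rightarrow> 'a set \<Rightarrow> ('a, 'm, 'y) module_scheme
    \<Rightarrow> 'm set"
  where
  "kappa R E I M =
     \<Inter>{V. submodule V R M \<and>
         cogenerated_by R (Hom_module R (ideal_module R I) E) (quotient_module M V)}"

end

theory Submission
  imports Defs
begin

text \<open>
  Four inclusions hold for every module \<open>M\<close>:
  \<open>I M \<subseteq> \<gamma>(M) \<subseteq> M[Ann I]\<close> and \<open>(Ann I) M \<subseteq> \<kappa>(M) \<subseteq> M[I]\<close>.  In the first chain, \<open>I M\<close> is the sum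
  of the images \<open>I x\<close> of \<open>I\<close>, and everything generated by \<open>I\<close> is killed by \<open>Ann I\<close>
  (\<open>ideal_times_subset_gamma\<close>, \<open>gamma_subset_torsion\<close>).  In the second chain, everything
  cogenerated by \<open>Hom(I, E)\<close> is killed by \<open>Ann I\<close> (\<open>ideal_times_Ann_subset_kappa\<close>), and \<open>M / M[I]\<close> is
  cogenerated by \<open>Hom(I, E)\<close> because \<open>E\<close> is a cogenerator (\<open>kappa_subset_torsion\<close>,
  \<open>injective_hull_cogenerator\<close>).

  The chains close up by one further inclusion each, valid for every ideal \<open>J\<close> of a commutative
  noetherian ring: \<open>M[Ann J] \<subseteq> J M\<close> for injective \<open>M\<close> (\<open>injective_torsion_subset\<close>) and
  \<open>M[J] \<subseteq> (Ann J) M\<close> for flat \<open>M\<close> (\<open>flat_torsion_subset\<close>).  Both rest on the embedding of \<open>R / Ann J\<close>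
  into a free module \<open>R\<^sup>n\<close> given by finitely many generators of \<open>J\<close>
  (\<open>quotient_by_Ann_embeds_in_free\<close>): along it, a homomorphism to an injective module extends, and
  tensoring it with a flat module keeps it injective.  The case \<open>J = I\<close> gives the equalities of
  the theorem, and the case \<open>J = Ann I\<close> gives the bounds that involve \<open>Ann (Ann I)\<close>.

  That \<open>E\<close> is a cogenerator for modules on every type needs Baer's criterion
  (\<open>linear_graph_extends_to_hom\<close>), since the definition of injectivity tests only modules on one
  particular type.
\<close>

section \<open>Submodules and homomorphisms\<close>

lemma (in module) submodule_zero: "submodule V R M \<Longrightarrow> \<zero>\<^bsub>M\<^esub> \<in> V"
  using submodule.axioms(1) subgroup.one_closed by force

text \<open>Closure under additive inverses comes for free, because negation is multiplication by \<open>-1\<close>.\<close>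

lemma (in module) submoduleI_smult:
  assumes "H \<subseteq> carrier M" "\<zero>\<^bsub>M\<^esub> \<in> H"
    and "\<And>x y. \<lbrakk>x \<in> H; y \<in> H\<rbrakk> \<Longrightarrow> x \<oplus>\<^bsub>M\<^esub> y \<in> H"
    and "\<And>a x. \<lbrakk>a \<in> carrier R; x \<in> H\<rbrakk> \<Longrightarrow> a \<odot>\<^bsub>M\<^esub> x \<in> H"
  shows "submodule H R M"
proof (rule submoduleI)
  fix x assume "x \<in> H"
  then have "(\<ominus> \<one>) \<odot>\<^bsub>M\<^esub> x = \<ominus>\<^bsub>M\<^esub> x"
    using assms(1) by (auto simp: smult_l_minus)
  moreover have "(\<ominus> \<one>) \<odot>\<^bsub>M\<^esub> x \<in> H"
    using \<open>x \<in> H\<close> by (intro assms(4)) simp_all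
  ultimately show "\<ominus>\<^bsub>M\<^esub> x \<in> H" by simp
qed (use assms in auto)

lemma (in module) generated_submodule_submodule:
  assumes "S \<subseteq> carrier M"
  shows "submodule (generated_submodule R M S) R M"
  unfolding generated_submodule_def
proof (rule submoduleI_smult)
  show "\<Inter>{U. submodule U R M \<and> S \<subseteq> U} \<subseteq> carrier M"
    using carrier_is_submodule assms by blast
qed (auto intro: submodule_zero submoduleE)

lemma generated_submodule_superset: "S \<subseteq> generated_submodule R M S"
  by (auto simp: generated_submodule_def)

lemma generated_submodule_least:
  "\<lbrakk>submodule U R M; S \<subseteq> U\<rbrakk> \<Longrightarrow> generated_submodule R M S \<subseteq> U"
  by (auto simp: generated_submodule_def)

lemma (in module) ideal_times_submodule:
  "J \<subseteq> carrier R \<Longrightarrow> submodule (ideal_times R J M) R M"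
  unfolding ideal_times_def by (rule generated_submodule_submodule) auto

lemma (in module) smult_in_ideal_times:
  "\<lbrakk>a \<in> J; x \<in> carrier M\<rbrakk> \<Longrightarrow> a \<odot>\<^bsub>M\<^esub> x \<in> ideal_times R J M"
  unfolding ideal_times_def by (rule subsetD[OF generated_submodule_superset]) blast

lemma (in module) ideal_times_least:
  assumes "submodule U R M" "\<And>a x. \<lbrakk>a \<in> J; x \<in> carrier M\<rbrakk> \<Longrightarrow> a \<odot>\<^bsub>M\<^esub> x \<in> U"
  shows "ideal_times R J M \<subseteq> U"
  unfolding ideal_times_def by (rule generated_submodule_least) (use assms in auto)

lemma (in module) torsion_submodule:
  assumes "J \<subseteq> carrier R"
  shows "submodule (torsion M J) R M"
proof (rule submoduleI_smult)
  fix c x assume c: "c \<in> carrier R" and x: "x \<in> torsion M J"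
  have "b \<odot>\<^bsub>M\<^esub> (c \<odot>\<^bsub>M\<^esub> x) = \<zero>\<^bsub>M\<^esub>" if "b \<in> J" for b
  proof -
    have "b \<odot>\<^bsub>M\<^esub> (c \<odot>\<^bsub>M\<^esub> x) = c \<odot>\<^bsub>M\<^esub> (b \<odot>\<^bsub>M\<^esub> x)"
      using c x that assms R.m_comm[of b c]
      by (subst (1 2) smult_assoc1[symmetric]) (auto simp: torsion_def)
    then show ?thesis using c x that by (simp add: torsion_def)
  qed
  then show "c \<odot>\<^bsub>M\<^esub> x \<in> torsion M J"
    using c x by (auto simp: torsion_def)
qed (use assms in \<open>auto simp: torsion_def smult_r_distr subset_iff\<close>)

lemma (in cring) Ann_ideal:
  assumes "J \<subseteq> carrier R"
  shows "ideal (Ann R J) R"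
proof (rule idealI)
  show "subgroup (Ann R J) (add_monoid R)"
    by (rule add.subgroupI)
      (use assms in \<open>auto simp: Ann_def l_distr l_minus subset_iff\<close>)
next
  fix a x assume a: "a \<in> Ann R J" and x: "x \<in> carrier R"
  then show "x \<otimes> a \<in> Ann R J"
    using assms by (auto simp: Ann_def m_assoc subset_iff)
  then show "a \<otimes> x \<in> Ann R J"
    using a x by (simp add: Ann_def m_comm)
qed (rule ring_axioms)

lemma (in module) module_homD:
  assumes "h \<in> module_hom R M N"
  shows "x \<in> carrier M \<Longrightarrow> h x \<in> carrier N"
    and "\<lbrakk>x \<in> carrier M; y \<in> carrier M\<rbrakk> \<Longrightarrow> h (x \<oplus>\<^bsub>M\<^esub> y) = h x \<oplus>\<^bsub>N\<^esub> h y"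
    and "\<lbrakk>a \<in> carrier R; x \<in> carrier M\<rbrakk> \<Longrightarrow> h (a \<odot>\<^bsub>M\<^esub> x) = a \<odot>\<^bsub>N\<^esub> h x"
  using assms by (auto simp: module_hom_def)

lemma module_hom_zero:
  assumes "module R M" "module R N" "h \<in> module_hom R M N"
  shows "h \<zero>\<^bsub>M\<^esub> = \<zero>\<^bsub>N\<^esub>"
proof -
  interpret M: module R M by fact
  interpret N: module R N by fact
  have "h (\<zero>\<^bsub>R\<^esub> \<odot>\<^bsub>M\<^esub> \<zero>\<^bsub>M\<^esub>) = \<zero>\<^bsub>R\<^esub> \<odot>\<^bsub>N\<^esub> h \<zero>\<^bsub>M\<^esub>"
    using assms(3) by (intro M.module_homD(3)) auto
  then show ?thesis using M.module_homD(1)[OF assms(3)] by simp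
qed

lemma module_hom_minus:
  assumes "module R M" "module R N" "h \<in> module_hom R M N" "x \<in> carrier M" "y \<in> carrier M"
  shows "h (x \<ominus>\<^bsub>M\<^esub> y) = h x \<ominus>\<^bsub>N\<^esub> h y"
proof -
  interpret M: module R M by fact
  interpret N: module R N by fact
  have "h (x \<oplus>\<^bsub>M\<^esub> (\<ominus>\<^bsub>R\<^esub> \<one>\<^bsub>R\<^esub>) \<odot>\<^bsub>M\<^esub> y) = h x \<oplus>\<^bsub>N\<^esub> (\<ominus>\<^bsub>R\<^esub> \<one>\<^bsub>R\<^esub>) \<odot>\<^bsub>N\<^esub> h y"
    using M.module_homD[OF assms(3)] assms(4,5) by simp
  then show ?thesis
    using M.module_homD(1)[OF assms(3)] assms(4,5)
    by (simp add: a_minus_def M.smult_l_minus N.smult_l_minus)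
qed

lemma vimage_submodule:
  assumes "module R M" "module R N" "h \<in> module_hom R M N" "submodule V R N"
  shows "submodule {x \<in> carrier M. h x \<in> V} R M"
proof -
  interpret M: module R M by fact
  interpret N: module R N by fact
  show ?thesis
    by (rule M.submoduleI_smult)
      (use assms N.submoduleE[OF assms(4)] M.module_homD[OF assms(3)] N.submodule_zero
       in \<open>auto simp: module_hom_zero[OF assms(1-3)]\<close>)
qed

section \<open>Ideals, powers and quotients as modules\<close>

lemma regular_module_simps [simp]:
  "carrier (regular_module R) = carrier R" "\<zero>\<^bsub>regular_module R\<^esub> = \<zero>\<^bsub>R\<^esub>"
  "x \<oplus>\<^bsub>regular_module R\<^esub> y = x \<oplus>\<^bsub>R\<^esub> y" "x \<odot>\<^bsub>regular_module R\<^esub> y = x \<otimes>\<^bsub>R\<^esub> y"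
  by (auto simp: regular_module_def)

lemma ideal_module_simps [simp]:
  "carrier (ideal_module R I) = I" "\<zero>\<^bsub>ideal_module R I\<^esub> = \<zero>\<^bsub>R\<^esub>"
  "x \<oplus>\<^bsub>ideal_module R I\<^esub> y = x \<oplus>\<^bsub>R\<^esub> y" "x \<odot>\<^bsub>ideal_module R I\<^esub> y = x \<otimes>\<^bsub>R\<^esub> y"
  by (auto simp: regular_module_def ideal_module_def)

lemma power_module_simps [simp]:
  "carrier (power_module \<Lambda> M) = (\<Lambda> \<rightarrow>\<^sub>E carrier M)"
  "\<zero>\<^bsub>power_module \<Lambda> M\<^esub> = (\<lambda>l\<in>\<Lambda>. \<zero>\<^bsub>M\<^esub>)"
  "f \<oplus>\<^bsub>power_module \<Lambda> M\<^esub> g = (\<lambda>l\<in>\<Lambda>. f l \<oplus>\<^bsub>M\<^esub> g l)"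
  "a \<odot>\<^bsub>power_module \<Lambda> M\<^esub> f = (\<lambda>l\<in>\<Lambda>. a \<odot>\<^bsub>M\<^esub> f l)"
  by (auto simp: power_module_def)

lemma copower_module_simps [simp]:
  "carrier (copower_module \<Lambda> M) = {f \<in> \<Lambda> \<rightarrow>\<^sub>E carrier M. finite {l \<in> \<Lambda>. f l \<noteq> \<zero>\<^bsub>M\<^esub>}}"
  "\<zero>\<^bsub>copower_module \<Lambda> M\<^esub> = (\<lambda>l\<in>\<Lambda>. \<zero>\<^bsub>M\<^esub>)"
  "f \<oplus>\<^bsub>copower_module \<Lambda> M\<^esub> g = (\<lambda>l\<in>\<Lambda>. f l \<oplus>\<^bsub>M\<^esub> g l)"
  "a \<odot>\<^bsub>copower_module \<Lambda> M\<^esub> f = (\<lambda>l\<in>\<Lambda>. a \<odot>\<^bsub>M\<^esub> f l)"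
  by (auto simp: power_module_def copower_module_def)

lemma (in cring) regular_module_module: "module R (regular_module R)"
  by (rule moduleI, rule is_cring, rule abelian_groupI)
    (auto simp: l_distr r_distr m_assoc a_assoc a_comm a_lcomm intro: l_neg)

lemma (in ideal) ideal_submodule: 
  assumes "cring R" shows "submodule I R (regular_module R)"
proof -
  interpret cring R by fact
  interpret m: module R "regular_module R" by (rule regular_module_module)
  show ?thesis
    by (rule m.submoduleI_smult) (use a_subset I_l_closed in auto)
qed

lemma (in ideal) ideal_module_module: "cring R \<Longrightarrow> module R (ideal_module R I)"
  using submodule.submodule_is_module[OF ideal_submodule] cring.regular_module_module
  by (metis ideal_module_def)

lemma (in module) power_module_module: "module R (power_module \<Lambda> M)"
proof (rule moduleI)
  show "abelian_group (power_module \<Lambda> M)"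
  proof (rule abelian_groupI)
    fix f assume f: "f \<in> carrier (power_module \<Lambda> M)"
    show "\<exists>g\<in>carrier (power_module \<Lambda> M). g \<oplus>\<^bsub>power_module \<Lambda> M\<^esub> f = \<zero>\<^bsub>power_module \<Lambda> M\<^esub>"
      by (rule bexI[where x="\<lambda>l\<in>\<Lambda>. \<ominus>\<^bsub>M\<^esub> f l"]) (use f in \<open>auto simp: PiE_iff M.l_neg fun_eq_iff\<close>)
  next
    fix f assume f: "f \<in> carrier (power_module \<Lambda> M)"
    then show "\<zero>\<^bsub>power_module \<Lambda> M\<^esub> \<oplus>\<^bsub>power_module \<Lambda> M\<^esub> f = f"
      by (auto simp: PiE_iff fun_eq_iff extensional_def)
  qed (auto simp: PiE_iff M.a_assoc M.a_comm M.a_lcomm fun_eq_iff)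
next
  fix f assume f: "f \<in> carrier (power_module \<Lambda> M)"
  then show "\<one> \<odot>\<^bsub>power_module \<Lambda> M\<^esub> f = f"
    by (auto simp: PiE_iff fun_eq_iff extensional_def)
qed (auto simp: PiE_iff fun_eq_iff R.is_cring smult_l_distr smult_r_distr smult_assoc1)

lemma (in module) copower_module_module: "module R (copower_module \<Lambda> M)"
proof -
  interpret P: module R "power_module \<Lambda> M" by (rule power_module_module)
  have "submodule (carrier (copower_module \<Lambda> M)) R (power_module \<Lambda> M)"
  proof (rule P.submoduleI_smult)
    fix f g assume fg: "f \<in> carrier (copower_module \<Lambda> M)" "g \<in> carrier (copower_module \<Lambda> M)"
    have "finite ({l \<in> \<Lambda>. f l \<noteq> \<zero>\<^bsub>M\<^esub>} \<union> {l \<in> \<Lambda>. g l \<noteq> \<zero>\<^bsub>M\<^esub>})" using fg by simp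
    then have "finite {l \<in> \<Lambda>. f l \<oplus>\<^bsub>M\<^esub> g l \<noteq> \<zero>\<^bsub>M\<^esub>}"
      by (rule rev_finite_subset) auto
    then show "f \<oplus>\<^bsub>power_module \<Lambda> M\<^esub> g \<in> carrier (copower_module \<Lambda> M)"
      using fg by (auto cong: conj_cong)
  next
    fix a f assume a: "a \<in> carrier R" and f: "f \<in> carrier (copower_module \<Lambda> M)"
    then have "finite {l \<in> \<Lambda>. f l \<noteq> \<zero>\<^bsub>M\<^esub>}" by simp
    then have "finite {l \<in> \<Lambda>. a \<odot>\<^bsub>M\<^esub> f l \<noteq> \<zero>\<^bsub>M\<^esub>}"
      by (rule rev_finite_subset) (use a in auto)
    then show "a \<odot>\<^bsub>power_module \<Lambda> M\<^esub> f \<in> carrier (copower_module \<Lambda> M)"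
      using f a by (auto cong: conj_cong)
  qed (auto cong: conj_cong)
  from submodule.submodule_is_module[OF this P.module_axioms] show ?thesis
    unfolding copower_module_def by simp
qed

lemma quotient_module_simps [simp]:
  "carrier (quotient_module M V) = a_rcosets\<^bsub>M\<^esub> V" "\<zero>\<^bsub>quotient_module M V\<^esub> = V"
  "C \<oplus>\<^bsub>quotient_module M V\<^esub> D = C <+>\<^bsub>M\<^esub> D"
  by (auto simp: quotient_module_def)

lemma (in module) submodule_abelian_subgroup:
  assumes "submodule V R M" shows "abelian_subgroup V M"
  using assms by (intro abelian_subgroupI3 additive_subgroup.intro submodule.axioms(1) M.abelian_group_axioms)

lemma (in module) coset_eq_iff:
  assumes "submodule V R M" "x \<in> carrier M" "y \<in> carrier M"
  shows "V +>\<^bsub>M\<^esub> x = V +>\<^bsub>M\<^esub> y \<longleftrightarrow> x \<ominus>\<^bsub>M\<^esub> y \<in> V"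
proof -
  interpret V: abelian_subgroup V M by (rule submodule_abelian_subgroup) fact
  show ?thesis
    using V.a_rcos_module[of y x] V.a_rcos_self[of x] a_repr_independence[OF _ _ V.a_subgroup, of x y] assms(2,3)
    by (auto simp: a_minus_def)
qed

lemma (in module) coset_eq_zero_iff:
  assumes "submodule V R M" "x \<in> carrier M"
  shows "V +>\<^bsub>M\<^esub> x = V \<longleftrightarrow> x \<in> V"
  using M.a_coset_join1 M.a_coset_join2 assms submodule.axioms(1) by metis

text \<open>In the quotient, scalar multiplication is defined as a union over all representatives; it is the
  expected coset because all members of that union coincide.\<close>

lemma (in module) quotient_smult:
  assumes V: "submodule V R M" and "a \<in> carrier R" "x \<in> carrier M"
  shows "a \<odot>\<^bsub>quotient_module M V\<^esub> (V +>\<^bsub>M\<^esub> x) = V +>\<^bsub>M\<^esub> (a \<odot>\<^bsub>M\<^esub> x)"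
proof -
  interpret V: abelian_subgroup V M by (rule submodule_abelian_subgroup) fact
  have "V +>\<^bsub>M\<^esub> (a \<odot>\<^bsub>M\<^esub> y) = V +>\<^bsub>M\<^esub> (a \<odot>\<^bsub>M\<^esub> x)" if "y \<in> V +>\<^bsub>M\<^esub> x" for y
  proof -
    have y: "y \<in> carrier M" using that assms V.a_elemrcos_carrier by blast
    have "y \<ominus>\<^bsub>M\<^esub> x \<in> V"
      using that assms y V.a_rcos_module[of x y] by (simp add: a_minus_def)
    then have "a \<odot>\<^bsub>M\<^esub> (y \<ominus>\<^bsub>M\<^esub> x) \<in> V"
      using submoduleE(4)[OF V] assms by blast
    then show ?thesis
      using assms y by (simp add: coset_eq_iff a_minus_def smult_r_distr smult_r_minus)
  qed
  moreover have "V +>\<^bsub>M\<^esub> x \<noteq> {}"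
    using V.a_rcos_self[OF assms(3)] by blast
  ultimately show ?thesis
    by (simp add: quotient_module_def)
qed

lemma (in module) quotient_module_module:
  assumes V: "submodule V R M" shows "module R (quotient_module M V)"
proof -
  interpret V: abelian_subgroup V M by (rule submodule_abelian_subgroup) fact
  have ag: "abelian_group (quotient_module M V)"
  proof (rule abelian_groupI)
    fix C assume "C \<in> carrier (quotient_module M V)"
    then obtain x where x: "x \<in> carrier M" "C = V +>\<^bsub>M\<^esub> x"
      by (auto simp: A_RCOSETS_def')
    then have "(V +>\<^bsub>M\<^esub> (\<ominus>\<^bsub>M\<^esub> x)) \<oplus>\<^bsub>quotient_module M V\<^esub> C = \<zero>\<^bsub>quotient_module M V\<^esub>"
      using submoduleE(1)[OF V] by (simp add: V.a_rcos_sum M.l_neg)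
    then show "\<exists>D\<in>carrier (quotient_module M V).
        D \<oplus>\<^bsub>quotient_module M V\<^esub> C = \<zero>\<^bsub>quotient_module M V\<^esub>"
      using x(1) by (intro bexI[where x="V +>\<^bsub>M\<^esub> (\<ominus>\<^bsub>M\<^esub> x)"]) (auto simp: A_RCOSETS_def')
  next
    show "\<zero>\<^bsub>quotient_module M V\<^esub> \<in> carrier (quotient_module M V)"
      using V.a_subgroup_in_rcosets by simp
  next
    fix C assume "C \<in> carrier (quotient_module M V)"
    then show "\<zero>\<^bsub>quotient_module M V\<^esub> \<oplus>\<^bsub>quotient_module M V\<^esub> C = C"
      by (simp add: V.rcosets_add_eq)
  qed (auto simp: A_RCOSETS_def' V.a_rcos_sum M.a_ac)
  have coset: "\<exists>x\<in>carrier M. C = V +>\<^bsub>M\<^esub> x" if "C \<in> carrier (quotient_module M V)" for C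
    using that by (auto simp: A_RCOSETS_def')
  note simps = quotient_smult[OF V] V.a_rcos_sum
  show ?thesis
  proof (rule moduleI[OF R.is_cring ag])
    fix a C D
    assume a: "a \<in> carrier R" and "C \<in> carrier (quotient_module M V)" "D \<in> carrier (quotient_module M V)"
    then obtain x y where x: "x \<in> carrier M" "C = V +>\<^bsub>M\<^esub> x" and y: "y \<in> carrier M" "D = V +>\<^bsub>M\<^esub> y"
      using coset by metis
    show "a \<odot>\<^bsub>quotient_module M V\<^esub> (C \<oplus>\<^bsub>quotient_module M V\<^esub> D) =
        a \<odot>\<^bsub>quotient_module M V\<^esub> C \<oplus>\<^bsub>quotient_module M V\<^esub> a \<odot>\<^bsub>quotient_module M V\<^esub> D"
      using a x y by (simp add: simps smult_r_distr)
  next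
    fix a b C
    assume a: "a \<in> carrier R" and b: "b \<in> carrier R" and "C \<in> carrier (quotient_module M V)"
    then obtain x where x: "x \<in> carrier M" "C = V +>\<^bsub>M\<^esub> x" using coset by metis
    show "(a \<oplus> b) \<odot>\<^bsub>quotient_module M V\<^esub> C =
        a \<odot>\<^bsub>quotient_module M V\<^esub> C \<oplus>\<^bsub>quotient_module M V\<^esub> b \<odot>\<^bsub>quotient_module M V\<^esub> C"
      using a b x by (simp add: simps smult_l_distr)
    show "(a \<otimes> b) \<odot>\<^bsub>quotient_module M V\<^esub> C =
        a \<odot>\<^bsub>quotient_module M V\<^esub> (b \<odot>\<^bsub>quotient_module M V\<^esub> C)"
      using a b x by (simp add: simps smult_assoc1)
  next
    fix a C assume a: "a \<in> carrier R" and "C \<in> carrier (quotient_module M V)"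
    then obtain x where x: "x \<in> carrier M" "C = V +>\<^bsub>M\<^esub> x" using coset by metis
    then show "a \<odot>\<^bsub>quotient_module M V\<^esub> C \<in> carrier (quotient_module M V)"
      using a by (auto simp: simps A_RCOSETS_def')
  next
    fix C assume "C \<in> carrier (quotient_module M V)"
    then obtain x where x: "x \<in> carrier M" "C = V +>\<^bsub>M\<^esub> x" using coset by metis
    then show "\<one> \<odot>\<^bsub>quotient_module M V\<^esub> C = C" by (simp add: simps)
  qed
qed

lemma (in module) coset_hom:
  assumes V: "submodule V R M"
  shows "(\<lambda>x. V +>\<^bsub>M\<^esub> x) \<in> module_hom R M (quotient_module M V)"
proof -
  interpret V: abelian_subgroup V M by (rule submodule_abelian_subgroup) fact
  show ?thesis
    by (auto simp: module_hom_def A_RCOSETS_def' quotient_smult[OF V] V.a_rcos_sum)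
qed

section \<open>Free modules and torsion in injective modules\<close>

lemma (in cring) unit_vector_simps:
  "unit_vector R S s \<in> S \<rightarrow>\<^sub>E carrier R"
  "t \<in> S \<Longrightarrow> unit_vector R S s t = (if t = s then \<one> else \<zero>)"
  by (auto simp: unit_vector_def)

text \<open>The vector is the sum of its coordinate vectors, built up coordinate by coordinate.\<close>

lemma (in cring) free_module_vector_in_submodule:
  fixes n :: nat
  defines "F \<equiv> power_module {..<n} (regular_module R)"
  assumes W: "submodule W R F" and a: "a \<in> {..<n} \<rightarrow>\<^sub>E carrier R"
    and unit: "\<And>i. i < n \<Longrightarrow> a i \<odot>\<^bsub>F\<^esub> unit_vector R {..<n} i \<in> W"
  shows "a \<in> W"
proof -
  interpret F: module R F
    unfolding F_def by (rule module.power_module_module[OF regular_module_module])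
  let ?t = "\<lambda>k. \<lambda>j\<in>{..<n}. if j < k then a j else \<zero>"
  have "?t k \<in> W" if "k \<le> n" for k
    using that
  proof (induction k)
    case 0
    have "?t 0 = \<zero>\<^bsub>F\<^esub>" by (auto simp: F_def)
    then show ?case using F.submodule_zero[OF W] by simp
  next
    case (Suc k)
    have "?t (Suc k) = ?t k \<oplus>\<^bsub>F\<^esub> (a k \<odot>\<^bsub>F\<^esub> unit_vector R {..<n} k)"
      using Suc.prems a by (auto simp: F_def unit_vector_simps(2) PiE_iff fun_eq_iff less_Suc_eq)
    moreover have "?t k \<oplus>\<^bsub>F\<^esub> (a k \<odot>\<^bsub>F\<^esub> unit_vector R {..<n} k) \<in> W"
      by (rule F.submoduleE(5)[OF W Suc.IH unit]) (use Suc.prems in simp_all)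
    ultimately show ?case by (simp only:)
  qed
  then have "?t n \<in> W" by simp
  moreover have "?t n = a" using a by (auto simp: fun_eq_iff PiE_iff extensional_def)
  ultimately show ?thesis by simp
qed

text \<open>The test modules in the definition of injectivity have elements of type \<^typ>\<open>nat \<Rightarrow> 'a\<close>.  A free
  module of finite rank, realised on the index set \<open>{..<n}\<close>, is of exactly this type, and so are all
  its submodules; for these, injectivity can be applied directly.\<close>

lemma injective_module_extend:
  fixes R :: "('a, 'r) ring_scheme" and M :: "('a, 'm, 'y) module_scheme" and n :: nat
  defines "F \<equiv> power_module {..<n} (regular_module R)"
  assumes M: "injective_module R M" and U: "submodule U R F"
    and g: "g \<in> module_hom R (F\<lparr>carrier := U\<rparr>) M"
  obtains h where "h \<in> module_hom R F M" "\<And>u. u \<in> U \<Longrightarrow> h u = g u"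
proof -
  have "cring R" using M by (auto simp: injective_module_def module_def)
  then have F: "module R F"
    unfolding F_def by (intro module.power_module_module cring.regular_module_module)
  then have "module R (F\<lparr>carrier := U\<rparr>)"
    using U by (rule submodule.submodule_is_module[rotated])
  moreover have "(\<lambda>x. x) \<in> module_hom R (F\<lparr>carrier := U\<rparr>) F"
    using module.submoduleE(1)[OF F U] by (auto simp: module_hom_def)
  moreover have "\<exists>h \<in> module_hom R B M. \<forall>x\<in>carrier A. h (f x) = g x"
    if "module R A" "f \<in> module_hom R A B" "module R B" "inj_on f (carrier A)" "g \<in> module_hom R A M"
    for A B :: "('a, nat \<Rightarrow> 'a) module" and f g
    using M that unfolding injective_module_def by blast
  ultimately have "\<exists>h \<in> module_hom R F M. \<forall>x\<in>carrier (F\<lparr>carrier := U\<rparr>). h x = g x"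
    using F g by (metis inj_on_id2)
  then show ?thesis using that by auto
qed

lemma (in module) ideal_multiples_submodule:
  assumes "ideal J R" and x: "x \<in> carrier M"
  shows "submodule ((\<lambda>r. r \<odot>\<^bsub>M\<^esub> x) ` J) R M"
proof -
  interpret J: ideal J R by fact
  have JR: "r \<in> carrier R" if "r \<in> J" for r using that J.a_subset by blast
  show ?thesis
  proof (rule submoduleI_smult)
    show "(\<lambda>r. r \<odot>\<^bsub>M\<^esub> x) ` J \<subseteq> carrier M" using x JR by auto
    show "\<zero>\<^bsub>M\<^esub> \<in> (\<lambda>r. r \<odot>\<^bsub>M\<^esub> x) ` J"
      by (rule image_eqI[of _ _ \<zero>]) (use x in auto)
  next
    fix u v assume "u \<in> (\<lambda>r. r \<odot>\<^bsub>M\<^esub> x) ` J" "v \<in> (\<lambda>r. r \<odot>\<^bsub>M\<^esub> x) ` J"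
    then obtain r s where "r \<in> J" "s \<in> J" "u = r \<odot>\<^bsub>M\<^esub> x" "v = s \<odot>\<^bsub>M\<^esub> x" by auto
    then show "u \<oplus>\<^bsub>M\<^esub> v \<in> (\<lambda>r. r \<odot>\<^bsub>M\<^esub> x) ` J"
      using x JR by (intro image_eqI[of _ _ "r \<oplus> s"]) (auto simp: smult_l_distr)
  next
    fix c u assume "c \<in> carrier R" "u \<in> (\<lambda>r. r \<odot>\<^bsub>M\<^esub> x) ` J"
    then obtain r where "c \<in> carrier R" "r \<in> J" "u = r \<odot>\<^bsub>M\<^esub> x" by auto
    then show "c \<odot>\<^bsub>M\<^esub> u \<in> (\<lambda>r. r \<odot>\<^bsub>M\<^esub> x) ` J"
      using x JR by (intro image_eqI[of _ _ "c \<otimes> r"]) (auto simp: smult_assoc1 J.I_l_closed)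
  qed
qed

lemma cyclic_submodule_hom:
  assumes M: "module R M" and N: "module R N" and a: "a \<in> carrier M" and y: "y \<in> carrier N"
    and compat: "\<And>r s. \<lbrakk>r \<in> carrier R; s \<in> carrier R; r \<odot>\<^bsub>M\<^esub> a = s \<odot>\<^bsub>M\<^esub> a\<rbrakk>
      \<Longrightarrow> r \<odot>\<^bsub>N\<^esub> y = s \<odot>\<^bsub>N\<^esub> y"
  shows "\<exists>h \<in> module_hom R (M\<lparr>carrier := (\<lambda>r. r \<odot>\<^bsub>M\<^esub> a) ` carrier R\<rparr>) N.
    \<forall>r\<in>carrier R. h (r \<odot>\<^bsub>M\<^esub> a) = r \<odot>\<^bsub>N\<^esub> y"
proof -
  interpret M: module R M by fact
  interpret N: module R N by fact
  define coef where "coef u = (SOME r. r \<in> carrier R \<and> u = r \<odot>\<^bsub>M\<^esub> a)" for u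
  have coef: "coef (r \<odot>\<^bsub>M\<^esub> a) \<odot>\<^bsub>N\<^esub> y = r \<odot>\<^bsub>N\<^esub> y" if "r \<in> carrier R" for r
    using that someI[of "\<lambda>s. s \<in> carrier R \<and> r \<odot>\<^bsub>M\<^esub> a = s \<odot>\<^bsub>M\<^esub> a" r]
    unfolding coef_def by (intro compat) auto
  let ?U = "(\<lambda>r. r \<odot>\<^bsub>M\<^esub> a) ` carrier R"
  have coef_add: "coef (r \<odot>\<^bsub>M\<^esub> a \<oplus>\<^bsub>M\<^esub> s \<odot>\<^bsub>M\<^esub> a) \<odot>\<^bsub>N\<^esub> y = r \<odot>\<^bsub>N\<^esub> y \<oplus>\<^bsub>N\<^esub> s \<odot>\<^bsub>N\<^esub> y"
    if "r \<in> carrier R" "s \<in> carrier R" for r s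
    using that coef[of "r \<oplus>\<^bsub>R\<^esub> s"] a y by (simp add: M.smult_l_distr N.smult_l_distr)
  have coef_smult: "coef (c \<odot>\<^bsub>M\<^esub> (r \<odot>\<^bsub>M\<^esub> a)) \<odot>\<^bsub>N\<^esub> y = c \<odot>\<^bsub>N\<^esub> (r \<odot>\<^bsub>N\<^esub> y)"
    if "c \<in> carrier R" "r \<in> carrier R" for c r
    using that coef[of "c \<otimes>\<^bsub>R\<^esub> r"] a y by (simp add: M.smult_assoc1 N.smult_assoc1)
  have "(\<lambda>u. coef u \<odot>\<^bsub>N\<^esub> y) \<in> module_hom R (M\<lparr>carrier := ?U\<rparr>) N"
    using y unfolding module_hom_def by (auto simp: coef coef_add coef_smult)
  then show ?thesis by (rule rev_bexI) (simp add: coef)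
qed

text \<open>This is where the noetherian hypothesis acts.  If \<open>a\<close> lists generators of \<open>J\<close>, then an
  element of \<open>R\<close> that kills all entries of \<open>a\<close> kills \<open>J\<close>.  Hence \<open>r \<mapsto> r a\<close> is a homomorphism
  \<open>R \<rightarrow> R\<^sup>n\<close> with kernel \<open>Ann J\<close>; in other words \<open>R / Ann J\<close> is isomorphic to the cyclic
  submodule of \<open>R\<^sup>n\<close> generated by a vector with entries in \<open>J\<close>.\<close>

lemma (in noetherian_ring) quotient_by_Ann_embeds_in_free:
  assumes "cring R" "ideal J R"
  obtains n :: nat and a where "a \<in> {..<n} \<rightarrow>\<^sub>E J"
    "\<And>r s. \<lbrakk>r \<in> carrier R; s \<in> carrier R;
      r \<odot>\<^bsub>power_module {..<n} (regular_module R)\<^esub> a = s \<odot>\<^bsub>power_module {..<n} (regular_module R)\<^esub> a\<rbrakk>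
      \<Longrightarrow> r \<ominus> s \<in> Ann R J"
proof -
  interpret cring R by fact
  interpret J: ideal J R by fact
  obtain A where A: "A \<subseteq> carrier R" "finite A" "J = Idl A"
    using finetely_gen assms by blast
  obtain b n where b: "A = b ` {..<n::nat}"
    using A(2) finite_conv_nat_seg_image[of A] by (auto simp: lessThan_def)
  have AJ: "A \<subseteq> J" using genideal_self[OF A(1)] A(3) by simp
  show ?thesis
  proof (rule that[of "restrict b {..<n}" n])
    show "restrict b {..<n} \<in> {..<n} \<rightarrow>\<^sub>E J" using b AJ by auto
    fix r s assume r': "r \<in> carrier R" and s': "s \<in> carrier R"
      and eq: "r \<odot>\<^bsub>power_module {..<n} (regular_module R)\<^esub> restrict b {..<n} =
        s \<odot>\<^bsub>power_module {..<n} (regular_module R)\<^esub> restrict b {..<n}"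
    define t where "t = r \<ominus> s"
    have t: "t \<in> carrier R" using r' s' by (simp add: t_def)
    have ann: "t \<otimes> b i = \<zero>" if i: "i < n" for i
    proof -
      have "b i \<in> carrier R" using i b A(1) by auto
      moreover have "r \<otimes> b i = s \<otimes> b i" using fun_cong[OF eq, of i] i by simp
      ultimately show ?thesis
        using r' s' by (simp add: t_def a_minus_def l_distr l_minus r_neg)
    qed
    have "ideal (Ann R {t}) R" using t by (intro Ann_ideal) simp
    moreover have "A \<subseteq> Ann R {t}"
    proof
      fix c assume c: "c \<in> A"
      then obtain i where "i < n" "c = b i" by (auto simp: b)
      then have "c \<otimes> t = \<zero>" using ann[of i] A(1) t c m_comm[of c t] by auto
      then show "c \<in> Ann R {t}" using A(1) c by (auto simp: Ann_def)
    qed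
    ultimately have "J \<subseteq> Ann R {t}"
      unfolding A(3) by (rule genideal_minimal)
    then have "t \<otimes> c = \<zero>" if "c \<in> J" for c
      using that t m_comm[of t c] J.a_subset by (auto simp: Ann_def)
    then show "r \<ominus> s \<in> Ann R J" using t by (simp add: Ann_def flip: t_def)
  qed
qed

text \<open>Let \<open>x\<close> be killed by \<open>Ann J\<close>, and let \<open>a\<close> be the vector from the previous embedding of \<open>R / Ann J\<close>.
  Then \<open>r a \<mapsto> r x\<close> is well defined on the cyclic submodule generated by \<open>a\<close>, and it extends to a
  homomorphism \<open>h : R\<^sup>n \<rightarrow> M\<close>.  Therefore \<open>x = h(a) = \<Sum> a\<^sub>i h(e\<^sub>i)\<close>, which lies in \<open>J M\<close>.\<close>

lemma (in noetherian_ring) injective_torsion_subset: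
  assumes "cring R" and M: "injective_module R M" and J: "ideal J R"
  shows "torsion M (Ann R J) \<subseteq> ideal_times R J M"
proof
  interpret cring R by fact
  interpret M: module R M using M by (simp add: injective_module_def)
  interpret J: ideal J R by fact
  fix x assume x: "x \<in> torsion M (Ann R J)"
  then have xM: "x \<in> carrier M" by (simp add: torsion_def)
  obtain n :: nat and a where a: "a \<in> {..<n} \<rightarrow>\<^sub>E J"
    and ann: "\<And>r s. \<lbrakk>r \<in> carrier R; s \<in> carrier R;
      r \<odot>\<^bsub>power_module {..<n} (regular_module R)\<^esub> a = s \<odot>\<^bsub>power_module {..<n} (regular_module R)\<^esub> a\<rbrakk>
      \<Longrightarrow> r \<ominus> s \<in> Ann R J"
    using quotient_by_Ann_embeds_in_free[OF assms(1) J] by metis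
  define F where "F = power_module {..<n} (regular_module R)"
  interpret F: module R F
    unfolding F_def by (rule module.power_module_module[OF regular_module_module])
  have aF: "a \<in> carrier F" and aR: "a \<in> {..<n} \<rightarrow>\<^sub>E carrier R"
    using a J.a_subset by (auto simp: F_def PiE_iff)
  let ?U = "(\<lambda>r. r \<odot>\<^bsub>F\<^esub> a) ` carrier R"
  have U: "submodule ?U R F"
    by (rule F.ideal_multiples_submodule[OF oneideal aF])
  have "r \<odot>\<^bsub>M\<^esub> x = s \<odot>\<^bsub>M\<^esub> x"
    if r: "r \<in> carrier R" and s: "s \<in> carrier R" and eq: "r \<odot>\<^bsub>F\<^esub> a = s \<odot>\<^bsub>F\<^esub> a" for r s
  proof -
    have "r \<ominus> s \<in> Ann R J" using ann[OF r s] eq by (simp add: F_def)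
    then have "(r \<ominus> s) \<odot>\<^bsub>M\<^esub> x = \<zero>\<^bsub>M\<^esub>" using x by (simp add: torsion_def)
    then show ?thesis
      using r s xM by (simp add: a_minus_def M.smult_l_distr M.smult_l_minus M.add.inv_solve_right')
  qed
  then obtain g where g: "g \<in> module_hom R (F\<lparr>carrier := ?U\<rparr>) M"
      "\<And>r. r \<in> carrier R \<Longrightarrow> g (r \<odot>\<^bsub>F\<^esub> a) = r \<odot>\<^bsub>M\<^esub> x"
    using cyclic_submodule_hom[OF F.module_axioms M.module_axioms aF xM] by meson
  obtain h where h: "h \<in> module_hom R F M" "\<And>u. u \<in> ?U \<Longrightarrow> h u = g u"
    using injective_module_extend[OF M, of ?U n, folded F_def, OF U g(1)] by metis
  have JM: "submodule (ideal_times R J M) R M" by (rule M.ideal_times_submodule[OF J.a_subset])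
  have "a \<in> {u \<in> carrier F. h u \<in> ideal_times R J M}"
  proof (rule free_module_vector_in_submodule[where n = n, folded F_def])
    show "submodule {u \<in> carrier F. h u \<in> ideal_times R J M} R F"
      by (rule vimage_submodule[OF F.module_axioms M.module_axioms h(1) JM])
    fix i assume i: "i < n"
    have e: "unit_vector R {..<n} i \<in> carrier F" using unit_vector_simps(1) by (simp add: F_def)
    have ai: "a i \<in> J" "a i \<in> carrier R" using i a J.a_subset by auto
    have "h (a i \<odot>\<^bsub>F\<^esub> unit_vector R {..<n} i) \<in> ideal_times R J M"
      using F.module_homD[OF h(1)] e ai by (auto intro: M.smult_in_ideal_times)
    then show "a i \<odot>\<^bsub>F\<^esub> unit_vector R {..<n} i \<in> {u \<in> carrier F. h u \<in> ideal_times R J M}"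
      using e ai by simp
  qed (rule aR)
  then have "h a \<in> ideal_times R J M" by simp
  moreover have "h (\<one> \<odot>\<^bsub>F\<^esub> a) = \<one> \<odot>\<^bsub>M\<^esub> x"
    using h(2)[OF imageI[OF one_closed]] g(2)[OF one_closed] by simp
  ultimately show "x \<in> ideal_times R J M" using aF xM by simp
qed

section \<open>Extension of homomorphisms into an injective module\<close>

text \<open>The hypothesis of Baer's criterion: an ideal of \<open>R\<close> sits inside \<open>R\<^sup>1\<close>, so that a homomorphism from
  it extends to \<open>R\<^sup>1\<close> and is multiplication by the image of the unit vector.\<close>

lemma injective_module_ideal_hom:
  assumes E: "injective_module R E" and J: "ideal J R" and h: "h \<in> module_hom R (ideal_module R J) E"
  obtains e where "e \<in> carrier E" "\<And>r. r \<in> J \<Longrightarrow> h r = r \<odot>\<^bsub>E\<^esub> e"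
proof -
  interpret E: module R E using E by (simp add: injective_module_def)
  interpret J: ideal J R by fact
  define F where "F = power_module {..<1::nat} (regular_module R)"
  interpret F: module R F
    unfolding F_def by (rule module.power_module_module[OF E.R.regular_module_module])
  define U where "U = {..<1::nat} \<rightarrow>\<^sub>E J"
  have U: "submodule U R F"
    by (rule F.submoduleI_smult) (use J.a_subset J.I_l_closed in \<open>auto simp: F_def U_def PiE_iff\<close>)
  have U0: "u 0 \<in> J" if "u \<in> U" for u using that by (auto simp: U_def)
  have "(\<lambda>f. h (f 0)) \<in> module_hom R (F\<lparr>carrier := U\<rparr>) E"
    using h U0 by (auto simp: module_hom_def F_def U_def[symmetric])
  then obtain k where k: "k \<in> module_hom R F E" "\<And>u. u \<in> U \<Longrightarrow> k u = h (u 0)"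
    using injective_module_extend[OF E, of U 1] U unfolding F_def by metis
  let ?e = "unit_vector R {..<1::nat} 0"
  have e: "?e \<in> carrier F" using E.R.unit_vector_simps(1) by (simp add: F_def)
  show ?thesis
  proof (rule that)
    show "k ?e \<in> carrier E" using F.module_homD(1)[OF k(1) e] .
    fix r assume r: "r \<in> J"
    then have rR: "r \<in> carrier R" using J.a_subset by auto
    have re: "r \<odot>\<^bsub>F\<^esub> ?e = (\<lambda>i\<in>{..<1}. r)"
      using rR by (auto simp: F_def fun_eq_iff unit_vector_def)
    have "h r = k (r \<odot>\<^bsub>F\<^esub> ?e)"
      unfolding re using k(2)[of "\<lambda>i\<in>{..<1}. r"] r by (simp add: U_def)
    then show "h r = r \<odot>\<^bsub>E\<^esub> k ?e"
      using F.module_homD(3)[OF k(1) rR e] by simp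
  qed
qed

text \<open>Graphs of homomorphisms from submodules of \<open>M\<close> to \<open>E\<close>.  As sets of pairs, partial homomorphisms are
  ordered by inclusion, as Zorn's lemma wants them, and no choice of default values outside the
  domain is involved.  The last clause makes the relation single-valued, since differences of pairs
  in the graph stay in it.\<close>

definition linear_graph ::
  "('a, 'r) ring_scheme \<Rightarrow> ('a, 'm, 'y) module_scheme \<Rightarrow> ('a, 'e, 'z) module_scheme \<Rightarrow> ('m \<times> 'e) set \<Rightarrow> bool"
  where
  "linear_graph R M E G \<longleftrightarrow> G \<subseteq> carrier M \<times> carrier E \<and> (\<zero>\<^bsub>M\<^esub>, \<zero>\<^bsub>E\<^esub>) \<in> G \<and>
     (\<forall>x d y e. (x, d) \<in> G \<longrightarrow> (y, e) \<in> G \<longrightarrow> (x \<oplus>\<^bsub>M\<^esub> y, d \<oplus>\<^bsub>E\<^esub> e) \<in> G) \<and>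
     (\<forall>a x d. a \<in> carrier R \<longrightarrow> (x, d) \<in> G \<longrightarrow> (a \<odot>\<^bsub>M\<^esub> x, a \<odot>\<^bsub>E\<^esub> d) \<in> G) \<and>
     (\<forall>d. (\<zero>\<^bsub>M\<^esub>, d) \<in> G \<longrightarrow> d = \<zero>\<^bsub>E\<^esub>)"

lemma linear_graphD:
  assumes "linear_graph R M E G"
  shows "(x, d) \<in> G \<Longrightarrow> x \<in> carrier M" "(x, d) \<in> G \<Longrightarrow> d \<in> carrier E"
    and "(\<zero>\<^bsub>M\<^esub>, \<zero>\<^bsub>E\<^esub>) \<in> G"
    and "\<lbrakk>(x, d) \<in> G; (y, e) \<in> G\<rbrakk> \<Longrightarrow> (x \<oplus>\<^bsub>M\<^esub> y, d \<oplus>\<^bsub>E\<^esub> e) \<in> G"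
    and "\<lbrakk>a \<in> carrier R; (x, d) \<in> G\<rbrakk> \<Longrightarrow> (a \<odot>\<^bsub>M\<^esub> x, a \<odot>\<^bsub>E\<^esub> d) \<in> G"
    and "(\<zero>\<^bsub>M\<^esub>, d) \<in> G \<Longrightarrow> d = \<zero>\<^bsub>E\<^esub>"
  using assms unfolding linear_graph_def by blast+

lemma linear_graph_diff:
  assumes "module R M" "module R E" "linear_graph R M E G" "(x, d) \<in> G" "(y, e) \<in> G"
  shows "(x \<ominus>\<^bsub>M\<^esub> y, d \<ominus>\<^bsub>E\<^esub> e) \<in> G"
proof -
  interpret M: module R M by fact
  interpret E: module R E by fact
  note G = linear_graphD[OF assms(3)]
  have "((\<ominus>\<^bsub>R\<^esub> \<one>\<^bsub>R\<^esub>) \<odot>\<^bsub>M\<^esub> y, (\<ominus>\<^bsub>R\<^esub> \<one>\<^bsub>R\<^esub>) \<odot>\<^bsub>E\<^esub> e) \<in> G"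
    using assms(5) by (intro G(5)) auto
  then have "(\<ominus>\<^bsub>M\<^esub> y, \<ominus>\<^bsub>E\<^esub> e) \<in> G"
    using G(1,2)[OF assms(5)] by (simp add: M.smult_l_minus E.smult_l_minus)
  then show ?thesis
    unfolding a_minus_def by (rule G(4)[OF assms(4)])
qed

lemma linear_graph_functional:
  assumes "module R M" "module R E" "linear_graph R M E G" "(x, d) \<in> G" "(x, e) \<in> G"
  shows "d = e"
proof -
  interpret M: module R M by fact
  interpret E: module R E by fact
  have "(x \<ominus>\<^bsub>M\<^esub> x, d \<ominus>\<^bsub>E\<^esub> e) \<in> G" by (rule linear_graph_diff[OF assms])
  then have "d \<ominus>\<^bsub>E\<^esub> e = \<zero>\<^bsub>E\<^esub>"
    using linear_graphD[OF assms(3)] assms(4) by (simp add: M.r_neg a_minus_def)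
  then show ?thesis
    using linear_graphD(2)[OF assms(3)] assms(4,5)
    by (simp add: a_minus_def E.M.add.inv_solve_right')
qed

lemma linear_graph_The:
  assumes "module R M" "module R E" "linear_graph R M E G" "(x, d) \<in> G"
  shows "(THE d. (x, d) \<in> G) = d"
proof (rule the_equality)
  fix e assume "(x, e) \<in> G"
  then show "e = d" by (rule linear_graph_functional[OF assms(1-3) _ assms(4)])
qed fact

text \<open>The inductive step in the proof of Baer's criterion.  The scalars \<open>r\<close> for which \<open>r x\<close> is in the
  domain form an ideal, on which \<open>r \<mapsto> h(r x)\<close> is multiplication by some \<open>e\<close>; sending \<open>x\<close> to \<open>e\<close>
  is then compatible with the given values.\<close>

lemma linear_graph_extend_step:
  assumes M: "module R M" and E: "injective_module R E" and G: "linear_graph R M E G"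
    and x: "x \<in> carrier M"
  obtains G' d where "linear_graph R M E G'" "G \<subseteq> G'" "(x, d) \<in> G'"
proof -
  interpret M: module R M by fact
  have E': "module R E" using E by (simp add: injective_module_def)
  interpret E: module R E by (rule E')
  note G' = linear_graphD[OF G]
  note diff = linear_graph_diff[OF M E' G]
  define J where "J = {r \<in> carrier R. \<exists>d. (r \<odot>\<^bsub>M\<^esub> x, d) \<in> G}"
  have J: "ideal J R"
  proof (rule idealI)
    show "subgroup J (add_monoid R)"
    proof (rule M.R.add.subgroupI)
      show "J \<noteq> {}" using G'(3) x by (auto simp: J_def intro!: exI[of _ "\<zero>\<^bsub>R\<^esub>"])
      fix r s assume r: "r \<in> J" 
      then obtain d where d: "r \<in> carrier R" "(r \<odot>\<^bsub>M\<^esub> x, d) \<in> G" by (auto simp: J_def)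
      then have "(\<zero>\<^bsub>M\<^esub> \<ominus>\<^bsub>M\<^esub> (r \<odot>\<^bsub>M\<^esub> x), \<zero>\<^bsub>E\<^esub> \<ominus>\<^bsub>E\<^esub> d) \<in> G"
        by (intro diff G'(3))
      then have "((\<ominus>\<^bsub>R\<^esub> r) \<odot>\<^bsub>M\<^esub> x, \<zero>\<^bsub>E\<^esub> \<ominus>\<^bsub>E\<^esub> d) \<in> G"
        using d x by (simp add: a_minus_def M.smult_l_minus)
      then show "\<ominus>\<^bsub>R\<^esub> r \<in> J" using d by (auto simp: J_def)
      assume "s \<in> J"
      then obtain e where e: "s \<in> carrier R" "(s \<odot>\<^bsub>M\<^esub> x, e) \<in> G" by (auto simp: J_def)
      then have "((r \<oplus>\<^bsub>R\<^esub> s) \<odot>\<^bsub>M\<^esub> x, d \<oplus>\<^bsub>E\<^esub> e) \<in> G"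
        using d x G'(4) by (simp add: M.smult_l_distr)
      then show "r \<oplus>\<^bsub>R\<^esub> s \<in> J" using d e by (auto simp: J_def)
    qed (auto simp: J_def)
  next
    fix r c assume r: "r \<in> J" and c: "c \<in> carrier R"
    then obtain d where d: "r \<in> carrier R" "(r \<odot>\<^bsub>M\<^esub> x, d) \<in> G" by (auto simp: J_def)
    then have "((c \<otimes>\<^bsub>R\<^esub> r) \<odot>\<^bsub>M\<^esub> x, c \<odot>\<^bsub>E\<^esub> d) \<in> G"
      using G'(5)[OF c d(2)] c x by (simp add: M.smult_assoc1)
    then show "c \<otimes>\<^bsub>R\<^esub> r \<in> J" using c d by (auto simp: J_def)
    then show "r \<otimes>\<^bsub>R\<^esub> c \<in> J" using c d by (simp add: M.R.m_comm)
  qed (rule M.R.ring_axioms)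
  interpret J: ideal J R by (rule J)
  define h where "h r = (THE d. (r \<odot>\<^bsub>M\<^esub> x, d) \<in> G)" for r
  have h_eq: "h r = d" if "(r \<odot>\<^bsub>M\<^esub> x, d) \<in> G" for r d
    unfolding h_def using that by (rule linear_graph_The[OF M E' G])
  have h_G: "(r \<odot>\<^bsub>M\<^esub> x, h r) \<in> G" if r: "r \<in> J" for r
  proof -
    obtain d where "(r \<odot>\<^bsub>M\<^esub> x, d) \<in> G" using r unfolding J_def by blast
    then show ?thesis by (simp add: h_eq)
  qed
  have "h \<in> module_hom R (ideal_module R J) E"
    unfolding module_hom_def
  proof (intro CollectI conjI ballI)
    show "h \<in> carrier (ideal_module R J) \<rightarrow> carrier E" using h_G G'(2) by auto
    fix r s assume "r \<in> carrier (ideal_module R J)" "s \<in> carrier (ideal_module R J)"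
    then have rs: "r \<in> J" "s \<in> J" by auto
    then have "((r \<oplus>\<^bsub>R\<^esub> s) \<odot>\<^bsub>M\<^esub> x, h r \<oplus>\<^bsub>E\<^esub> h s) \<in> G"
      using G'(4)[OF h_G h_G] x J.a_subset by (auto simp: M.smult_l_distr)
    then show "h (r \<oplus>\<^bsub>ideal_module R J\<^esub> s) = h r \<oplus>\<^bsub>E\<^esub> h s" by (simp add: h_eq)
  next
    fix c r assume c: "c \<in> carrier R" and "r \<in> carrier (ideal_module R J)"
    then have r: "r \<in> J" by auto
    then have "((c \<otimes>\<^bsub>R\<^esub> r) \<odot>\<^bsub>M\<^esub> x, c \<odot>\<^bsub>E\<^esub> h r) \<in> G"
      using G'(5)[OF c h_G[OF r]] x c J.a_subset by (auto simp: M.smult_assoc1)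
    then show "h (c \<odot>\<^bsub>ideal_module R J\<^esub> r) = c \<odot>\<^bsub>E\<^esub> h r" by (simp add: h_eq)
  qed
  then obtain e where e: "e \<in> carrier E" "\<And>r. r \<in> J \<Longrightarrow> h r = r \<odot>\<^bsub>E\<^esub> e"
    using injective_module_ideal_hom[OF E J] by blast
  define K where "K = {(y \<oplus>\<^bsub>M\<^esub> r \<odot>\<^bsub>M\<^esub> x, d \<oplus>\<^bsub>E\<^esub> r \<odot>\<^bsub>E\<^esub> e) | y d r. (y, d) \<in> G \<and> r \<in> carrier R}"
  have KI: "(z, c) \<in> K" if "z = y \<oplus>\<^bsub>M\<^esub> r \<odot>\<^bsub>M\<^esub> x" "c = d \<oplus>\<^bsub>E\<^esub> r \<odot>\<^bsub>E\<^esub> e" "(y, d) \<in> G" "r \<in> carrier R"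
    for z c y d r using that by (auto simp: K_def)
  have GK: "G \<subseteq> K"
  proof (rule subrelI)
    fix y d assume yd: "(y, d) \<in> G"
    then show "(y, d) \<in> K"
      using G'(1,2)[OF yd] x e by (intro KI[of _ y "\<zero>\<^bsub>R\<^esub>" _ d]) auto
  qed
  have "linear_graph R M E K"
    unfolding linear_graph_def
  proof (intro conjI allI impI)
    show "K \<subseteq> carrier M \<times> carrier E" using G'(1,2) x e by (auto simp: K_def)
    show "(\<zero>\<^bsub>M\<^esub>, \<zero>\<^bsub>E\<^esub>) \<in> K" using GK G'(3) by blast
  next
    fix y1 d1 y2 d2 assume "(y1, d1) \<in> K" "(y2, d2) \<in> K"
    then obtain z1 c1 r1 z2 c2 r2 where
      1: "(z1, c1) \<in> G" "r1 \<in> carrier R" "y1 = z1 \<oplus>\<^bsub>M\<^esub> r1 \<odot>\<^bsub>M\<^esub> x" "d1 = c1 \<oplus>\<^bsub>E\<^esub> r1 \<odot>\<^bsub>E\<^esub> e"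
      and 2: "(z2, c2) \<in> G" "r2 \<in> carrier R" "y2 = z2 \<oplus>\<^bsub>M\<^esub> r2 \<odot>\<^bsub>M\<^esub> x" "d2 = c2 \<oplus>\<^bsub>E\<^esub> r2 \<odot>\<^bsub>E\<^esub> e"
      unfolding K_def by blast
    show "(y1 \<oplus>\<^bsub>M\<^esub> y2, d1 \<oplus>\<^bsub>E\<^esub> d2) \<in> K"
      by (rule KI[of _ "z1 \<oplus>\<^bsub>M\<^esub> z2" "r1 \<oplus>\<^bsub>R\<^esub> r2" _ "c1 \<oplus>\<^bsub>E\<^esub> c2"])
        (use 1 2 x e G'(1,2)[OF 1(1)] G'(1,2)[OF 2(1)] G'(4)[OF 1(1) 2(1)] in
          \<open>simp_all add: M.smult_l_distr E.smult_l_distr M.M.a_ac E.M.a_ac\<close>)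
  next
    fix a y d assume a: "a \<in> carrier R" and "(y, d) \<in> K"
    then obtain z c r where
      1: "(z, c) \<in> G" "r \<in> carrier R" "y = z \<oplus>\<^bsub>M\<^esub> r \<odot>\<^bsub>M\<^esub> x" "d = c \<oplus>\<^bsub>E\<^esub> r \<odot>\<^bsub>E\<^esub> e"
      unfolding K_def by blast
    show "(a \<odot>\<^bsub>M\<^esub> y, a \<odot>\<^bsub>E\<^esub> d) \<in> K"
      by (rule KI[of _ "a \<odot>\<^bsub>M\<^esub> z" "a \<otimes>\<^bsub>R\<^esub> r" _ "a \<odot>\<^bsub>E\<^esub> c"])
        (use 1 a x e G'(1,2)[OF 1(1)] G'(5)[OF a 1(1)] in
          \<open>simp_all add: M.smult_r_distr E.smult_r_distr M.smult_assoc1 E.smult_assoc1\<close>)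
  next
    fix d assume "(\<zero>\<^bsub>M\<^esub>, d) \<in> K"
    then obtain z c r where
      1: "(z, c) \<in> G" "r \<in> carrier R" "\<zero>\<^bsub>M\<^esub> = z \<oplus>\<^bsub>M\<^esub> r \<odot>\<^bsub>M\<^esub> x" "d = c \<oplus>\<^bsub>E\<^esub> r \<odot>\<^bsub>E\<^esub> e"
      unfolding K_def by blast
    note zc = G'(1,2)[OF 1(1)]
    have "(\<zero>\<^bsub>M\<^esub> \<ominus>\<^bsub>M\<^esub> z, \<zero>\<^bsub>E\<^esub> \<ominus>\<^bsub>E\<^esub> c) \<in> G" by (rule diff[OF G'(3) 1(1)])
    moreover have "\<zero>\<^bsub>M\<^esub> \<ominus>\<^bsub>M\<^esub> z = r \<odot>\<^bsub>M\<^esub> x"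
      using 1 zc x M.M.minus_equality[of "r \<odot>\<^bsub>M\<^esub> x" z] by (simp add: a_minus_def M.M.a_comm)
    ultimately have "(r \<odot>\<^bsub>M\<^esub> x, \<ominus>\<^bsub>E\<^esub> c) \<in> G" using zc by (simp add: a_minus_def)
    then have "r \<in> J" "h r = \<ominus>\<^bsub>E\<^esub> c"
      using 1(2) h_eq unfolding J_def by blast+
    then have "r \<odot>\<^bsub>E\<^esub> e = \<ominus>\<^bsub>E\<^esub> c" using e(2) by metis
    then show "d = \<zero>\<^bsub>E\<^esub>" using 1(4) zc by (simp add: E.M.r_neg)
  qed
  moreover have "(x, e) \<in> K"
    using x e G'(3) by (intro KI[of _ "\<zero>\<^bsub>M\<^esub>" "\<one>\<^bsub>R\<^esub>" _ "\<zero>\<^bsub>E\<^esub>"]) auto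
  ultimately show ?thesis using that GK by blast
qed

lemma linear_graph_Union:
  assumes "\<C> \<noteq> {}" "subset.chain {G. linear_graph R M E G} \<C>"
  shows "linear_graph R M E (\<Union>\<C>)"
proof -
  have lin: "linear_graph R M E G" if "G \<in> \<C>" for G
    using that assms(2) by (auto simp: subset_chain_def)
  have join: "\<exists>K\<in>\<C>. p \<in> K \<and> q \<in> K" if "p \<in> \<Union>\<C>" "q \<in> \<Union>\<C>" for p q
    using that assms(2) unfolding subset_chain_def by blast
  show ?thesis
    unfolding linear_graph_def
  proof (intro conjI allI impI)
    show "\<Union>\<C> \<subseteq> carrier M \<times> carrier E" using lin by (fastforce simp: linear_graph_def)
    show "(\<zero>\<^bsub>M\<^esub>, \<zero>\<^bsub>E\<^esub>) \<in> \<Union>\<C>" using assms(1) linear_graphD(3)[OF lin] by blast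
  next
    fix x d y e assume "(x, d) \<in> \<Union>\<C>" "(y, e) \<in> \<Union>\<C>"
    then show "(x \<oplus>\<^bsub>M\<^esub> y, d \<oplus>\<^bsub>E\<^esub> e) \<in> \<Union>\<C>"
      using join linear_graphD(4)[OF lin] by blast
  qed (use linear_graphD(5,6)[OF lin] in blast)+
qed

text \<open>Injectivity is tested only on modules with elements of type \<^typ>\<open>nat \<Rightarrow> 'a\<close>; by Baer's criterion
  it gives extensions to modules on arbitrary types.  A maximal graph is total by the extension
  step.\<close>

proposition linear_graph_extends_to_hom:
  assumes M: "module R M" and E: "injective_module R E" and G: "linear_graph R M E G"
  obtains h where "h \<in> module_hom R M E" "\<And>x d. (x, d) \<in> G \<Longrightarrow> h x = d"
proof -
  have E': "module R E" using E by (simp add: injective_module_def)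
  define S where "S = {K. linear_graph R M E K \<and> G \<subseteq> K}"
  have "\<exists>K\<in>S. \<forall>L\<in>S. K \<subseteq> L \<longrightarrow> L = K"
  proof (rule subset_Zorn_nonempty)
    show "S \<noteq> {}" using G by (auto simp: S_def)
    fix \<C> assume \<C>: "\<C> \<noteq> {}" "subset.chain S \<C>"
    then have "linear_graph R M E (\<Union>\<C>)"
      by (intro linear_graph_Union) (auto simp: subset_chain_def S_def)
    moreover have "G \<subseteq> \<Union>\<C>" using \<C> by (auto 4 3 simp: subset_chain_def S_def subset_iff)
    ultimately show "\<Union>\<C> \<in> S" by (simp add: S_def)
  qed
  then obtain K where K: "linear_graph R M E K" "G \<subseteq> K"
    and max: "\<And>L. \<lbrakk>linear_graph R M E L; K \<subseteq> L\<rbrakk> \<Longrightarrow> L = K"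
    unfolding S_def by (smt (verit) mem_Collect_eq order_trans)
  have total: "\<exists>d. (x, d) \<in> K" if "x \<in> carrier M" for x
    using linear_graph_extend_step[OF M E K(1) that] max by metis
  define h where "h x = (THE d. (x, d) \<in> K)" for x
  have h_eq: "h x = d" if "(x, d) \<in> K" for x d
    unfolding h_def using that by (rule linear_graph_The[OF M E' K(1)])
  have h_K: "(x, h x) \<in> K" if "x \<in> carrier M" for x
    using total[OF that] h_eq by force
  show ?thesis
  proof (rule that)
    note K' = linear_graphD[OF K(1)]
    show "h \<in> module_hom R M E"
      unfolding module_hom_def
    proof (intro CollectI conjI ballI)
      show "h \<in> carrier M \<rightarrow> carrier E" using h_K K'(2) by blast
    qed (auto intro!: h_eq K'(4,5) h_K)
    show "h x = d" if "(x, d) \<in> G" for x d using that K(2) h_eq by blast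
  qed
qed

lemma (in noetherian_ring) proper_ideal_in_maximalideal:
  assumes J: "ideal J R" "J \<noteq> carrier R"
  obtains N where "maximalideal N R" "J \<subseteq> N"
proof -
  define S where "S = {K. ideal K R \<and> K \<noteq> carrier R \<and> J \<subseteq> K}"
  have "\<exists>K\<in>S. \<forall>L\<in>S. K \<subseteq> L \<longrightarrow> L = K"
  proof (rule subset_Zorn_nonempty)
    show "S \<noteq> {}" using J by (auto simp: S_def)
    fix \<C> assume \<C>: "\<C> \<noteq> {}" "subset.chain S \<C>"
    then have "subset.chain {K. ideal K R} \<C>" by (auto simp: subset_chain_def S_def)
    then have "\<Union>\<C> \<in> \<C>" using ideal_chain_is_trivial \<C>(1) by blast
    then show "\<Union>\<C> \<in> S" using \<C>(2) by (auto simp: subset_chain_def S_def)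
  qed
  then obtain N where N: "ideal N R" "N \<noteq> carrier R" "J \<subseteq> N" 
    and max: "\<And>L. L \<in> S \<Longrightarrow> N \<subseteq> L \<Longrightarrow> L = N"
    by (auto simp: S_def)
  show ?thesis
  proof (rule that[OF maximalidealI])
    fix K assume "ideal K R" "N \<subseteq> K"
    then show "K = N \<or> K = carrier R" using max[of K] N(3) by (auto simp: S_def)
  qed (use N in auto)
qed

text \<open>The injective hull of the residue field is a cogenerator: the annihilator of \<open>y \<noteq> 0\<close> is a proper
  ideal, hence lies in \<open>\<mm>\<close>, and \<open>r y \<mapsto> r + \<mm>\<close> is a nonzero homomorphism from \<open>R y\<close> to
  \<open>R / \<mm> \<subseteq> E\<close>, which extends to \<open>M\<close>.\<close>

proposition injective_hull_cogenerator:
  assumes "noetherian_ring R" and loc: "local_ring R \<mm>"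
    and hull: "injective_hull R (residue_field_module R \<mm>) E"
    and M: "module R M" and y: "y \<in> carrier M" "y \<noteq> \<zero>\<^bsub>M\<^esub>"
  obtains h where "h \<in> module_hom R M E" "h y \<noteq> \<zero>\<^bsub>E\<^esub>"
proof -
  interpret noetherian_ring R by fact
  interpret M: module R M by fact
  have E: "injective_module R E" "module R E"
    using hull by (auto simp: injective_hull_def injective_module_def)
  interpret E: module R E by (rule E(2))
  have mm: "maximalideal \<mm> R" using loc by (simp add: local_ring_def)
  interpret mm: maximalideal \<mm> R by (rule mm)
  let ?Rm = "regular_module R"
  interpret Rm: module R ?Rm by (rule M.R.regular_module_module)
  have mm_sub: "submodule \<mm> R ?Rm" by (rule mm.ideal_submodule[OF M.R.is_cring])
  have Q: "module R (residue_field_module R \<mm>)"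
    unfolding residue_field_module_def by (rule Rm.quotient_module_module[OF mm_sub])
  obtain i where i: "i \<in> module_hom R (residue_field_module R \<mm>) E"
      "inj_on i (carrier (residue_field_module R \<mm>))"
    using hull by (auto simp: injective_hull_def essential_mono_def)
  let ?\<pi> = "\<lambda>r. \<mm> +>\<^bsub>?Rm\<^esub> r"
  have \<pi>: "?\<pi> \<in> module_hom R ?Rm (residue_field_module R \<mm>)"
    unfolding residue_field_module_def by (rule Rm.coset_hom[OF mm_sub])
  define \<psi> where "\<psi> r = i (?\<pi> r)" for r
  have \<psi>: "\<psi> \<in> module_hom R ?Rm E"
    using \<pi> i(1) unfolding module_hom_def \<psi>_def by (auto simp: Pi_iff)
  note \<psi>D = Rm.module_homD[OF \<psi>, simplified]
  have zeroE: "i \<mm> = \<zero>\<^bsub>E\<^esub>"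
    using module_hom_zero[OF Q E(2) i(1)] by (simp add: residue_field_module_def)
  have coset_zero: "?\<pi> r = \<mm> \<longleftrightarrow> r \<in> \<mm>" if "r \<in> carrier R" for r
    using Rm.coset_eq_zero_iff[OF mm_sub] that by simp
  have kernel: "\<psi> r = \<zero>\<^bsub>E\<^esub>" if "r \<in> \<mm>" for r
    using coset_zero[of r] that mm.a_subset zeroE by (auto simp: \<psi>_def)
  have "\<one>\<^bsub>R\<^esub> \<notin> \<mm>" using mm.I_notcarr mm.one_imp_carrier by blast
  then have "?\<pi> \<one>\<^bsub>R\<^esub> \<noteq> \<mm>" using coset_zero by simp
  moreover have "?\<pi> \<one>\<^bsub>R\<^esub> \<in> carrier (residue_field_module R \<mm>)"
    using \<pi> by (auto simp: module_hom_def)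
  moreover have "\<mm> \<in> carrier (residue_field_module R \<mm>)"
    using module.submodule_zero[OF Q module.carrier_is_submodule[OF Q]]
    by (simp add: residue_field_module_def)
  ultimately have \<psi>1: "\<psi> \<one>\<^bsub>R\<^esub> \<noteq> \<zero>\<^bsub>E\<^esub>"
    unfolding \<psi>_def using inj_onD[OF i(2)] zeroE by metis
  define A where "A = {r \<in> carrier R. r \<odot>\<^bsub>M\<^esub> y = \<zero>\<^bsub>M\<^esub>}"
  have "ideal A R"
  proof (rule idealI)
    show "subgroup A (add_monoid R)"
      by (rule add.subgroupI) (use y in \<open>auto simp: A_def M.smult_l_distr M.smult_l_minus\<close>)
  next
    fix r c assume r: "r \<in> A" and c: "c \<in> carrier R"
    then show "c \<otimes>\<^bsub>R\<^esub> r \<in> A" using y by (auto simp: A_def M.smult_assoc1)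
    then show "r \<otimes>\<^bsub>R\<^esub> c \<in> A" using r c by (simp add: A_def M.R.m_comm)
  qed (rule ring_axioms)
  moreover have "A \<noteq> carrier R" using y M.smult_one[of y] by (force simp: A_def)
  ultimately obtain N where "maximalideal N R" "A \<subseteq> N"
    by (rule proper_ideal_in_maximalideal)
  then have A: "A \<subseteq> \<mm>" using loc by (auto simp: local_ring_def)
  define G where "G = (\<lambda>r. (r \<odot>\<^bsub>M\<^esub> y, \<psi> r)) ` carrier R"
  have GI: "(z, c) \<in> G" if "z = r \<odot>\<^bsub>M\<^esub> y" "c = \<psi> r" "r \<in> carrier R" for z c r
    using that by (auto simp: G_def)
  have "linear_graph R M E G"
    unfolding linear_graph_def
  proof (intro conjI allI impI)
    show "G \<subseteq> carrier M \<times> carrier E" using y \<psi>D(1) by (auto simp: G_def)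
    show "(\<zero>\<^bsub>M\<^esub>, \<zero>\<^bsub>E\<^esub>) \<in> G" using y kernel[OF mm.zero_closed] by (intro GI[of _ "\<zero>\<^bsub>R\<^esub>"]) auto
  next
    fix x d z e assume "(x, d) \<in> G" "(z, e) \<in> G"
    then obtain r s where "r \<in> carrier R" "s \<in> carrier R" "x = r \<odot>\<^bsub>M\<^esub> y" "d = \<psi> r"
      "z = s \<odot>\<^bsub>M\<^esub> y" "e = \<psi> s" by (auto simp: G_def)
    then show "(x \<oplus>\<^bsub>M\<^esub> z, d \<oplus>\<^bsub>E\<^esub> e) \<in> G"
      using y by (intro GI[of _ "r \<oplus>\<^bsub>R\<^esub> s"]) (auto simp: M.smult_l_distr \<psi>D)
  next
    fix a x d assume "a \<in> carrier R" "(x, d) \<in> G"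
    then obtain r where "a \<in> carrier R" "r \<in> carrier R" "x = r \<odot>\<^bsub>M\<^esub> y" "d = \<psi> r"
      by (auto simp: G_def)
    then show "(a \<odot>\<^bsub>M\<^esub> x, a \<odot>\<^bsub>E\<^esub> d) \<in> G"
      using y by (intro GI[of _ "a \<otimes>\<^bsub>R\<^esub> r"]) (auto simp: M.smult_assoc1 \<psi>D)
  next
    fix d assume "(\<zero>\<^bsub>M\<^esub>, d) \<in> G"
    then obtain r where "r \<in> carrier R" "\<zero>\<^bsub>M\<^esub> = r \<odot>\<^bsub>M\<^esub> y" "d = \<psi> r"
      by (auto simp: G_def)
    then show "d = \<zero>\<^bsub>E\<^esub>" using A kernel by (auto simp: A_def)
  qed
  then obtain h where h: "h \<in> module_hom R M E" "\<And>x d. (x, d) \<in> G \<Longrightarrow> h x = d"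
    using linear_graph_extends_to_hom[OF M E(1)] by metis
  have "(y, \<psi> \<one>\<^bsub>R\<^esub>) \<in> G" using y by (intro GI[of _ "\<one>\<^bsub>R\<^esub>"]) auto
  then show ?thesis using that h \<psi>1 by metis
qed

section \<open>Tensor products and flat modules\<close>

lemma (in module) submodule_minus_iff:
  assumes V: "submodule V R M" and "x \<ominus>\<^bsub>M\<^esub> y \<in> V" "x \<in> carrier M" "y \<in> carrier M"
  shows "x \<in> V \<longleftrightarrow> y \<in> V"
proof -
  have xy: "V +>\<^bsub>M\<^esub> x = V +>\<^bsub>M\<^esub> y" using coset_eq_iff assms by simp
  show ?thesis
    using coset_eq_zero_iff[OF V] assms(3,4) xy by metis
qed

lemma (in cring) unit_vector_copower:
  assumes "s \<in> S"
  shows "unit_vector R S s \<in> carrier (copower_module S (regular_module R))"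
proof -
  have "{t \<in> S. unit_vector R S s t \<noteq> \<zero>} \<subseteq> {s}" by (auto simp: unit_vector_def)
  then have "finite {t \<in> S. unit_vector R S s t \<noteq> \<zero>}" by (rule finite_subset) simp
  then show ?thesis using unit_vector_simps(1) by simp
qed

text \<open>The linear extension is the sum of \<open>f(s) \<beta>(s)\<close> over the support of \<open>f\<close>.  It is additive because
  this sum may as well be taken over any finite set that contains the support.\<close>

lemma (in module) copower_linear_extension:
  assumes \<beta>: "\<beta> \<in> S \<rightarrow> carrier M"
  obtains \<phi> where "\<phi> \<in> module_hom R (copower_module S (regular_module R)) M"
    "\<And>s. s \<in> S \<Longrightarrow> \<phi> (unit_vector R S s) = \<beta> s"
proof -
  let ?C = "carrier (copower_module S (regular_module R))"
  define \<phi> where "\<phi> f = (\<Oplus>\<^bsub>M\<^esub>s\<in>{s \<in> S. f s \<noteq> \<zero>}. f s \<odot>\<^bsub>M\<^esub> \<beta> s)" for f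
  have larger: "\<phi> f = (\<Oplus>\<^bsub>M\<^esub>s\<in>T. f s \<odot>\<^bsub>M\<^esub> \<beta> s)"
    if f: "f \<in> ?C" and T: "finite T" "T \<subseteq> S" "{s \<in> S. f s \<noteq> \<zero>} \<subseteq> T" for f T
    unfolding \<phi>_def
    by (rule M.add.finprod_mono_neutral_cong_left) (use f T \<beta> in \<open>auto simp: Pi_iff PiE_iff subset_iff\<close>)
  have supp: "finite {s \<in> S. f s \<noteq> \<zero>}" if "f \<in> ?C" for f
    using that by simp
  have terms: "f s \<odot>\<^bsub>M\<^esub> \<beta> s \<in> carrier M" if "f \<in> ?C" "s \<in> S" for f s
    using that \<beta> by (auto simp: PiE_iff)
  interpret C: module R "copower_module S (regular_module R)"
    by (rule module.copower_module_module[OF regular_module_module])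
  have "\<phi> \<in> module_hom R (copower_module S (regular_module R)) M"
    unfolding module_hom_def
  proof (intro CollectI conjI ballI)
    show "\<phi> \<in> ?C \<rightarrow> carrier M"
      using terms unfolding \<phi>_def by (auto intro!: M.finsum_closed)
  next
    fix f g assume f: "f \<in> ?C" and g: "g \<in> ?C"
    let ?fg = "f \<oplus>\<^bsub>copower_module S (regular_module R)\<^esub> g"
    let ?T = "{s \<in> S. f s \<noteq> \<zero>} \<union> {s \<in> S. g s \<noteq> \<zero>}"
    have fg: "?fg \<in> ?C" by (rule C.M.a_closed[OF f g])
    have T: "finite ?T" using supp[OF f] supp[OF g] by simp
    have "\<phi> ?fg = (\<Oplus>\<^bsub>M\<^esub>s\<in>?T. ?fg s \<odot>\<^bsub>M\<^esub> \<beta> s)"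
      by (rule larger[OF fg T]) auto
    also have "\<dots> = (\<Oplus>\<^bsub>M\<^esub>s\<in>?T. f s \<odot>\<^bsub>M\<^esub> \<beta> s \<oplus>\<^bsub>M\<^esub> g s \<odot>\<^bsub>M\<^esub> \<beta> s)"
      by (rule M.finsum_cong') (use f g \<beta> terms in \<open>auto simp: smult_l_distr PiE_iff Pi_iff\<close>)
    also have "\<dots> = (\<Oplus>\<^bsub>M\<^esub>s\<in>?T. f s \<odot>\<^bsub>M\<^esub> \<beta> s) \<oplus>\<^bsub>M\<^esub> (\<Oplus>\<^bsub>M\<^esub>s\<in>?T. g s \<odot>\<^bsub>M\<^esub> \<beta> s)"
      by (rule M.finsum_addf) (use f g terms in auto)
    also have "\<dots> = \<phi> f \<oplus>\<^bsub>M\<^esub> \<phi> g"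
      using larger[OF f T] larger[OF g T] by simp
    finally show "\<phi> ?fg = \<phi> f \<oplus>\<^bsub>M\<^esub> \<phi> g" .
  next
    fix a f assume a: "a \<in> carrier R" and f: "f \<in> ?C"
    let ?af = "a \<odot>\<^bsub>copower_module S (regular_module R)\<^esub> f"
    let ?T = "{s \<in> S. f s \<noteq> \<zero>}"
    have "\<phi> ?af = (\<Oplus>\<^bsub>M\<^esub>s\<in>?T. ?af s \<odot>\<^bsub>M\<^esub> \<beta> s)"
      by (rule larger[OF C.smult_closed[OF a f] supp[OF f]]) (use a in auto)
    also have "\<dots> = (\<Oplus>\<^bsub>M\<^esub>s\<in>?T. a \<odot>\<^bsub>M\<^esub> (f s \<odot>\<^bsub>M\<^esub> \<beta> s))"
      by (rule M.finsum_cong') (use f a \<beta> terms in \<open>auto simp: smult_assoc1 PiE_iff Pi_iff\<close>)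
    also have "\<dots> = a \<odot>\<^bsub>M\<^esub> \<phi> f"
      unfolding \<phi>_def by (rule finsum_smult_ldistr[symmetric]) (use supp[OF f] a terms[OF f] in auto)
    finally show "\<phi> ?af = a \<odot>\<^bsub>M\<^esub> \<phi> f" .
  qed
  moreover have "\<phi> (unit_vector R S s) = \<beta> s" if s: "s \<in> S" for s
  proof -
    have "\<phi> (unit_vector R S s) = (\<Oplus>\<^bsub>M\<^esub>t\<in>{s}. unit_vector R S s t \<odot>\<^bsub>M\<^esub> \<beta> t)"
      by (rule larger[OF unit_vector_copower[OF s]]) (use s in \<open>auto simp: unit_vector_def\<close>)
    then show ?thesis
      using s \<beta> by (simp add: unit_vector_simps Pi_iff)
  qed
  ultimately show ?thesis using that by blast
qed

abbreviation tensor_unit ::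
  "('a, 'r) ring_scheme \<Rightarrow> ('a, 'm, 'y) module_scheme \<Rightarrow> ('a, 'n, 'z) module_scheme
    \<Rightarrow> 'm \<Rightarrow> 'n \<Rightarrow> ('m \<times> 'n \<Rightarrow> 'a)"
  where "tensor_unit R M N x y \<equiv> unit_vector R (carrier M \<times> carrier N) (x, y)"

lemma tensor_free_module: "cring R \<Longrightarrow> module R (tensor_free R M N)"
  unfolding tensor_free_def by (intro module.copower_module_module cring.regular_module_module)

lemma tensor_unit_closed:
  "\<lbrakk>cring R; x \<in> carrier M; y \<in> carrier N\<rbrakk> \<Longrightarrow> tensor_unit R M N x y \<in> carrier (tensor_free R M N)"
  unfolding tensor_free_def by (intro cring.unit_vector_copower) auto

lemma tensor_relations:
  assumes M: "module R M" and N: "module R N"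
  shows tensor_relations_submodule: "submodule (tensor_relations R M N) R (tensor_free R M N)"
    and tensor_relations_add_left: "\<And>x x' y. \<lbrakk>x \<in> carrier M; x' \<in> carrier M; y \<in> carrier N\<rbrakk> \<Longrightarrow>
      tensor_unit R M N (x \<oplus>\<^bsub>M\<^esub> x') y \<ominus>\<^bsub>tensor_free R M N\<^esub>
        (tensor_unit R M N x y \<oplus>\<^bsub>tensor_free R M N\<^esub> tensor_unit R M N x' y) \<in> tensor_relations R M N"
    and tensor_relations_smult_left: "\<And>a x y. \<lbrakk>a \<in> carrier R; x \<in> carrier M; y \<in> carrier N\<rbrakk> \<Longrightarrow>
      tensor_unit R M N (a \<odot>\<^bsub>M\<^esub> x) y \<ominus>\<^bsub>tensor_free R M N\<^esub>
        (a \<odot>\<^bsub>tensor_free R M N\<^esub> tensor_unit R M N x y) \<in> tensor_relations R M N"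
    and tensor_relations_smult_right: "\<And>a x y. \<lbrakk>a \<in> carrier R; x \<in> carrier M; y \<in> carrier N\<rbrakk> \<Longrightarrow>
      tensor_unit R M N x (a \<odot>\<^bsub>N\<^esub> y) \<ominus>\<^bsub>tensor_free R M N\<^esub>
        (a \<odot>\<^bsub>tensor_free R M N\<^esub> tensor_unit R M N x y) \<in> tensor_relations R M N"
proof -
  interpret M: module R M by fact
  interpret N: module R N by fact
  interpret F: module R "tensor_free R M N" by (rule tensor_free_module[OF M.R.is_cring])
  note e = tensor_unit_closed[OF M.R.is_cring]
  show "submodule (tensor_relations R M N) R (tensor_free R M N)"
    unfolding tensor_relations_def Let_def
    by (rule F.generated_submodule_submodule) (auto intro!: F.M.minus_closed e)
qed (unfold tensor_relations_def Let_def,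
    (rule subsetD[OF generated_submodule_superset], blast)+)

text \<open>The universal property of the tensor product, stated on the free module above it.  It is used
  to show that an element is \<^emph>\<open>not\<close> a consequence of the bilinearity relations.\<close>

proposition tensor_relations_bilinear:
  assumes M: "module R M" and N: "module R N" and P: "module R P"
    and closed: "\<And>x y. \<lbrakk>x \<in> carrier M; y \<in> carrier N\<rbrakk> \<Longrightarrow> \<beta> x y \<in> carrier P"
    and add_left: "\<And>x x' y. \<lbrakk>x \<in> carrier M; x' \<in> carrier M; y \<in> carrier N\<rbrakk> \<Longrightarrow>
      \<beta> (x \<oplus>\<^bsub>M\<^esub> x') y = \<beta> x y \<oplus>\<^bsub>P\<^esub> \<beta> x' y"
    and add_right: "\<And>x y y'. \<lbrakk>x \<in> carrier M; y \<in> carrier N; y' \<in> carrier N\<rbrakk> \<Longrightarrow>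
      \<beta> x (y \<oplus>\<^bsub>N\<^esub> y') = \<beta> x y \<oplus>\<^bsub>P\<^esub> \<beta> x y'"
    and smult_left: "\<And>a x y. \<lbrakk>a \<in> carrier R; x \<in> carrier M; y \<in> carrier N\<rbrakk> \<Longrightarrow>
      \<beta> (a \<odot>\<^bsub>M\<^esub> x) y = a \<odot>\<^bsub>P\<^esub> \<beta> x y"
    and smult_right: "\<And>a x y. \<lbrakk>a \<in> carrier R; x \<in> carrier M; y \<in> carrier N\<rbrakk> \<Longrightarrow>
      \<beta> x (a \<odot>\<^bsub>N\<^esub> y) = a \<odot>\<^bsub>P\<^esub> \<beta> x y"
  obtains \<phi> where "\<phi> \<in> module_hom R (tensor_free R M N) P"
    "\<And>x y. \<lbrakk>x \<in> carrier M; y \<in> carrier N\<rbrakk> \<Longrightarrow> \<phi> (tensor_unit R M N x y) = \<beta> x y"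
    "\<And>f. f \<in> tensor_relations R M N \<Longrightarrow> \<phi> f = \<zero>\<^bsub>P\<^esub>"
proof -
  interpret M: module R M by fact
  interpret N: module R N by fact
  interpret P: module R P by fact
  have F: "module R (tensor_free R M N)" by (rule tensor_free_module[OF M.R.is_cring])
  interpret F: module R "tensor_free R M N" by (rule F)
  have e: "tensor_unit R M N x y \<in> carrier (tensor_free R M N)" if "x \<in> carrier M" "y \<in> carrier N" for x y
    using tensor_unit_closed[OF M.R.is_cring that] .
  have "(\<lambda>(x, y). \<beta> x y) \<in> carrier M \<times> carrier N \<rightarrow> carrier P" using closed by auto
  then obtain \<phi> where \<phi>: "\<phi> \<in> module_hom R (tensor_free R M N) P"
    and unit: "\<And>s. s \<in> carrier M \<times> carrier N \<Longrightarrow>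
      \<phi> (unit_vector R (carrier M \<times> carrier N) s) = (case s of (x, y) \<Rightarrow> \<beta> x y)"
    unfolding tensor_free_def by (rule P.copower_linear_extension) blast
  have \<phi>_e: "\<phi> (tensor_unit R M N x y) = \<beta> x y" if "x \<in> carrier M" "y \<in> carrier N" for x y
    using unit[of "(x, y)"] that by simp
  have \<phi>_minus: "\<phi> (f \<ominus>\<^bsub>tensor_free R M N\<^esub> g) = \<zero>\<^bsub>P\<^esub>"
    if "\<phi> f = \<phi> g" "f \<in> carrier (tensor_free R M N)" "g \<in> carrier (tensor_free R M N)" for f g
    using module_hom_minus[OF F P \<phi> that(2,3)] F.module_homD(1)[OF \<phi> that(3)] that(1)
    by (simp add: a_minus_def P.M.r_neg)
  let ?K = "{f \<in> carrier (tensor_free R M N). \<phi> f \<in> {\<zero>\<^bsub>P\<^esub>}}"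
  have "submodule {\<zero>\<^bsub>P\<^esub>} R P" by (rule P.submoduleI_smult) auto
  then have "submodule ?K R (tensor_free R M N)" by (rule vimage_submodule[OF F P \<phi>])
  then have "tensor_relations R M N \<subseteq> ?K"
    unfolding tensor_relations_def Let_def
    by (rule generated_submodule_least)
      (auto intro!: \<phi>_minus F.M.minus_closed e
        simp: \<phi>_e e F.module_homD(2,3)[OF \<phi>] add_left add_right smult_left smult_right)
  then show ?thesis using that[OF \<phi> \<phi>_e] by blast
qed

lemma tensor_unit_zero_right:
  assumes M: "module R M" and N: "module R N" and x: "x \<in> carrier M"
  shows "tensor_unit R M N x \<zero>\<^bsub>N\<^esub> \<in> tensor_relations R M N"
proof -
  interpret M: module R M by fact
  interpret N: module R N by fact
  interpret F: module R "tensor_free R M N" by (rule tensor_free_module[OF M.R.is_cring])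
  have e: "tensor_unit R M N x \<zero>\<^bsub>N\<^esub> \<in> carrier (tensor_free R M N)"
    by (rule tensor_unit_closed[OF M.R.is_cring x]) simp
  note T = tensor_relations_submodule[OF M N]
  have "tensor_unit R M N x (\<zero>\<^bsub>R\<^esub> \<odot>\<^bsub>N\<^esub> \<zero>\<^bsub>N\<^esub>) \<ominus>\<^bsub>tensor_free R M N\<^esub>
      \<zero>\<^bsub>R\<^esub> \<odot>\<^bsub>tensor_free R M N\<^esub> tensor_unit R M N x \<zero>\<^bsub>N\<^esub> \<in> tensor_relations R M N"
    by (rule tensor_relations_smult_right[OF M N]) (use x in auto)
  then have "tensor_unit R M N x \<zero>\<^bsub>N\<^esub> \<ominus>\<^bsub>tensor_free R M N\<^esub> \<zero>\<^bsub>tensor_free R M N\<^esub> \<in> tensor_relations R M N"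
    using e by simp
  then show ?thesis
    using F.submodule_minus_iff[OF T _ e F.M.zero_closed] F.submodule_zero[OF T] by blast
qed

text \<open>This is the kernel of \<open>x \<mapsto> x \<otimes> y\<close>.\<close>

lemma tensor_vanishing_submodule:
  assumes M: "module R M" and N: "module R N" and y: "y \<in> carrier N"
  shows "submodule {x \<in> carrier M. tensor_unit R M N x y \<in> tensor_relations R M N} R M"
    (is "submodule ?V R M")
proof -
  interpret M: module R M by fact
  interpret N: module R N by fact
  interpret F: module R "tensor_free R M N" by (rule tensor_free_module[OF M.R.is_cring])
  have e: "tensor_unit R M N x y \<in> carrier (tensor_free R M N)" if "x \<in> carrier M" for x
    by (rule tensor_unit_closed[OF M.R.is_cring that y])
  have T: "submodule (tensor_relations R M N) R (tensor_free R M N)"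
    by (rule tensor_relations_submodule[OF M N])
  have smult: "a \<odot>\<^bsub>M\<^esub> x \<in> ?V"
    if a: "a \<in> carrier R" and x: "x \<in> carrier M"
      and "a \<odot>\<^bsub>tensor_free R M N\<^esub> tensor_unit R M N x y \<in> tensor_relations R M N" for a x
    using that F.submodule_minus_iff[OF T tensor_relations_smult_left[OF M N a x y]] e by simp
  show ?thesis
  proof (rule M.submoduleI_smult)
    have "\<zero>\<^bsub>R\<^esub> \<odot>\<^bsub>M\<^esub> \<zero>\<^bsub>M\<^esub> \<in> ?V"
      by (rule smult) (use e[of "\<zero>\<^bsub>M\<^esub>"] F.submodule_zero[OF T] in auto)
    then show "\<zero>\<^bsub>M\<^esub> \<in> ?V" by simp
  next
    fix x x' assume "x \<in> ?V" "x' \<in> ?V"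
    then have x: "x \<in> carrier M" "x' \<in> carrier M"
      and "tensor_unit R M N x y \<oplus>\<^bsub>tensor_free R M N\<^esub> tensor_unit R M N x' y \<in> tensor_relations R M N"
      using F.submoduleE(5)[OF T] by auto
    then show "x \<oplus>\<^bsub>M\<^esub> x' \<in> ?V"
      using F.submodule_minus_iff[OF T tensor_relations_add_left[OF M N x y]] e by simp
  next
    fix a x assume "a \<in> carrier R" "x \<in> ?V"
    then show "a \<odot>\<^bsub>M\<^esub> x \<in> ?V"
      using F.submoduleE(4)[OF T] by (intro smult) auto
  qed auto
qed

lemma tensor_unit_annihilated:
  assumes M: "module R M" and N: "module R N" and "a \<in> carrier R" "x \<in> carrier M" "y \<in> carrier N"
    and "a \<odot>\<^bsub>N\<^esub> y = \<zero>\<^bsub>N\<^esub>"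
  shows "tensor_unit R M N (a \<odot>\<^bsub>M\<^esub> x) y \<in> tensor_relations R M N"
proof -
  interpret M: module R M by fact
  interpret N: module R N by fact
  interpret F: module R "tensor_free R M N" by (rule tensor_free_module[OF M.R.is_cring])
  note T = tensor_relations_submodule[OF M N]
  note e = tensor_unit_closed[OF M.R.is_cring assms(4) assms(5)]
    tensor_unit_closed[OF M.R.is_cring assms(4) N.M.zero_closed]
    tensor_unit_closed[OF M.R.is_cring M.smult_closed[OF assms(3,4)] assms(5)]
  have "a \<odot>\<^bsub>tensor_free R M N\<^esub> tensor_unit R M N x y \<in> tensor_relations R M N"
    using F.submodule_minus_iff[OF T tensor_relations_smult_right[OF M N assms(3-5)]]
      tensor_unit_zero_right[OF M N assms(4)] assms(3-6) e by simp
  then show ?thesis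
    using F.submodule_minus_iff[OF T tensor_relations_smult_left[OF M N assms(3-5)]] assms(3-5) e
    by simp
qed

text \<open>Let \<open>J x = 0\<close>, and let \<open>A = R a\<close> be the cyclic submodule of \<open>F = R\<^sup>n\<close> that is isomorphic to
  \<open>R / Ann J\<close>, where \<open>a\<close> has its entries in \<open>J\<close>.  In \<open>F \<otimes> M\<close> the tensor \<open>a \<otimes> x = \<Sum> e\<^sub>i \<otimes> a\<^sub>i x\<close>
  vanishes.  By flatness it vanishes already in \<open>A \<otimes> M\<close>, which maps to \<open>M / (Ann J) M\<close> by
  \<open>r a \<otimes> y \<mapsto> r y\<close>; so \<open>x\<close> lies in \<open>(Ann J) M\<close>.\<close>

proposition (in noetherian_ring) flat_torsion_subset:
  assumes "cring R" and flat: "flat_module R M" and J: "ideal J R"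
  shows "torsion M J \<subseteq> ideal_times R (Ann R J) M"
proof
  interpret cring R by fact
  have M: "module R M" using flat by (simp add: flat_module_def)
  interpret M: module R M by (rule M)
  interpret J: ideal J R by fact
  fix x assume x: "x \<in> torsion M J"
  then have xM: "x \<in> carrier M" by (simp add: torsion_def)
  obtain n :: nat and a where a: "a \<in> {..<n} \<rightarrow>\<^sub>E J"
    and ann: "\<And>r s. \<lbrakk>r \<in> carrier R; s \<in> carrier R;
      r \<odot>\<^bsub>power_module {..<n} (regular_module R)\<^esub> a = s \<odot>\<^bsub>power_module {..<n} (regular_module R)\<^esub> a\<rbrakk>
      \<Longrightarrow> r \<ominus> s \<in> Ann R J"
    using quotient_by_Ann_embeds_in_free[OF assms(1) J] by metis
  define F where "F = power_module {..<n} (regular_module R)"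
  interpret F: module R F
    unfolding F_def by (rule module.power_module_module[OF regular_module_module])
  have aF: "a \<in> carrier F" and aR: "a \<in> {..<n} \<rightarrow>\<^sub>E carrier R"
    using a J.a_subset by (auto simp: F_def PiE_iff)
  define U where "U = (\<lambda>r. r \<odot>\<^bsub>F\<^esub> a) ` carrier R"
  have U: "submodule U R F"
    unfolding U_def by (rule F.ideal_multiples_submodule[OF oneideal aF])
  define A where "A = F\<lparr>carrier := U\<rparr>"
  have A: "module R A"
    unfolding A_def by (rule submodule.submodule_is_module[OF U F.module_axioms])
  interpret A: module R A by (rule A)
  have A_simps: "carrier A = U" "\<And>u v. u \<oplus>\<^bsub>A\<^esub> v = u \<oplus>\<^bsub>F\<^esub> v" "\<And>r u. r \<odot>\<^bsub>A\<^esub> u = r \<odot>\<^bsub>F\<^esub> u"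
    "\<zero>\<^bsub>A\<^esub> = \<zero>\<^bsub>F\<^esub>"
    by (simp_all add: A_def)
  have UF: "U \<subseteq> carrier F" by (rule F.submoduleE(1)[OF U])
  have aU: "a \<in> U" unfolding U_def by (rule image_eqI[of _ _ \<one>]) (use aF in auto)

  have "(\<lambda>u. u) \<in> module_hom R A F" using UF by (auto simp: module_hom_def A_simps)
  then have "\<exists>g \<in> module_hom R (tensor_module R A M) (tensor_module R F M).
      (\<forall>u\<in>carrier A. \<forall>y\<in>carrier M. g (pure_tensor R A M u y) = pure_tensor R F M u y) \<and>
      inj_on g (carrier (tensor_module R A M))"
    using flat A F.module_axioms unfolding flat_module_def by (fast intro: inj_on_id2)
  then obtain g where
    g: "\<And>u y. \<lbrakk>u \<in> U; y \<in> carrier M\<rbrakk> \<Longrightarrow> g (pure_tensor R A M u y) = pure_tensor R F M u y"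
    and inj: "inj_on g (carrier (tensor_module R A M))"
    by (auto simp: A_simps)

  define TF where "TF = tensor_relations R F M"
  define TA where "TA = tensor_relations R A M"
  interpret FF: module R "tensor_free R F M" by (rule tensor_free_module[OF is_cring])
  interpret FA: module R "tensor_free R A M" by (rule tensor_free_module[OF is_cring])
  have TF: "submodule TF R (tensor_free R F M)"
    unfolding TF_def by (rule tensor_relations_submodule[OF F.module_axioms M])
  have TA: "submodule TA R (tensor_free R A M)"
    unfolding TA_def by (rule tensor_relations_submodule[OF A M])

  \<comment> \<open>The tensor of \<open>a\<close> and \<open>x\<close> vanishes in \<open>F \<otimes> M\<close>, hence in \<open>A \<otimes> M\<close> by injectivity of \<open>g\<close>.\<close>
  have "a \<in> {u \<in> carrier F. tensor_unit R F M u x \<in> TF}"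
  proof (rule free_module_vector_in_submodule[where n = n, folded F_def])
    show "submodule {u \<in> carrier F. tensor_unit R F M u x \<in> TF} R F"
      unfolding TF_def by (rule tensor_vanishing_submodule[OF F.module_axioms M xM])
    fix i assume i: "i < n"
    have e: "unit_vector R {..<n} i \<in> carrier F" using unit_vector_simps(1) by (simp add: F_def)
    have ai: "a i \<in> carrier R" "a i \<odot>\<^bsub>M\<^esub> x = \<zero>\<^bsub>M\<^esub>"
      using i a J.a_subset x by (auto simp: torsion_def)
    then show "a i \<odot>\<^bsub>F\<^esub> unit_vector R {..<n} i \<in> {u \<in> carrier F. tensor_unit R F M u x \<in> TF}"
      using tensor_unit_annihilated[OF F.module_axioms M ai(1) e xM ai(2)] e by (simp add: TF_def)
  qed (rule aR)
  then have aTF: "tensor_unit R F M a x \<in> TF" by simp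
  have "\<zero>\<^bsub>F\<^esub> \<in> {u \<in> carrier F. tensor_unit R F M u x \<in> TF}"
    unfolding TF_def by (rule F.submodule_zero[OF tensor_vanishing_submodule[OF F.module_axioms M xM]])
  then have "tensor_unit R F M \<zero>\<^bsub>F\<^esub> x \<in> TF" by simp
  then have "pure_tensor R F M a x = pure_tensor R F M \<zero>\<^bsub>F\<^esub> x"
    using aTF FF.coset_eq_zero_iff[OF TF] tensor_unit_closed[OF is_cring _ xM] aF
    unfolding pure_tensor_def TF_def[symmetric] by (metis F.M.zero_closed)
  moreover have "\<zero>\<^bsub>F\<^esub> \<in> U" by (rule F.submodule_zero[OF U])
  moreover have "pure_tensor R A M u x \<in> carrier (tensor_module R A M)" if "u \<in> U" for u
    using that FA.coset_hom[OF TA] tensor_unit_closed[OF is_cring _ xM, of u A]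
    unfolding pure_tensor_def tensor_module_def TA_def[symmetric]
    by (auto simp: module_hom_def A_simps)
  ultimately have pure_eq: "pure_tensor R A M a x = pure_tensor R A M \<zero>\<^bsub>A\<^esub> x"
    using g aU xM inj_onD[OF inj] A_simps(4) by metis
  have "\<zero>\<^bsub>A\<^esub> \<in> {u \<in> carrier A. tensor_unit R A M u x \<in> TA}"
    unfolding TA_def by (rule A.submodule_zero[OF tensor_vanishing_submodule[OF A M xM]])
  then have aTA: "tensor_unit R A M a x \<in> TA"
    using FA.coset_eq_zero_iff[OF TA tensor_unit_closed[OF is_cring _ xM, of _ A]] aU pure_eq
    by (auto simp: pure_tensor_def A_simps simp flip: TA_def)

  \<comment> \<open>The bilinear map \<open>(r a, y) \<mapsto> r y + (Ann J) M\<close> detects the tensor of \<open>a\<close> and \<open>x\<close>.\<close>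
  define W where "W = ideal_times R (Ann R J) M"
  have W: "submodule W R M"
    unfolding W_def by (rule M.ideal_times_submodule) (auto simp: Ann_def)
  have Q: "module R (quotient_module M W)" by (rule M.quotient_module_module[OF W])
  interpret Q: module R "quotient_module M W" by (rule Q)
  note coset = M.coset_hom[OF W]
  note cosetD = M.module_homD[OF coset]
  have "\<exists>h \<in> module_hom R A (quotient_module M W).
      \<forall>r\<in>carrier R. h (r \<odot>\<^bsub>F\<^esub> a) = r \<odot>\<^bsub>quotient_module M W\<^esub> (W +>\<^bsub>M\<^esub> y)"
    if y: "y \<in> carrier M" for y
    unfolding A_def U_def
  proof (rule cyclic_submodule_hom[OF F.module_axioms Q aF cosetD(1)[OF y]])
    fix r s assume r: "r \<in> carrier R" and s: "s \<in> carrier R" and eq: "r \<odot>\<^bsub>F\<^esub> a = s \<odot>\<^bsub>F\<^esub> a"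
    have "r \<ominus> s \<in> Ann R J" using ann[OF r s] eq by (simp add: F_def)
    then have "(r \<ominus> s) \<odot>\<^bsub>M\<^esub> y \<in> W"
      unfolding W_def using y by (rule M.smult_in_ideal_times)
    then show "r \<odot>\<^bsub>quotient_module M W\<^esub> (W +>\<^bsub>M\<^esub> y) = s \<odot>\<^bsub>quotient_module M W\<^esub> (W +>\<^bsub>M\<^esub> y)"
      using r s y
      by (simp add: M.quotient_smult[OF W] M.coset_eq_iff[OF W] a_minus_def M.smult_l_distr M.smult_l_minus)
  qed
  then obtain h where h: "\<And>y. y \<in> carrier M \<Longrightarrow> h y \<in> module_hom R A (quotient_module M W)"
    and h_a: "\<And>y r. \<lbrakk>y \<in> carrier M; r \<in> carrier R\<rbrakk> \<Longrightarrow> h y (r \<odot>\<^bsub>F\<^esub> a) = W +>\<^bsub>M\<^esub> (r \<odot>\<^bsub>M\<^esub> y)"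
    using M.quotient_smult[OF W] by metis
  have h_add: "h (y \<oplus>\<^bsub>M\<^esub> y') u = h y u \<oplus>\<^bsub>quotient_module M W\<^esub> h y' u"
    if u: "u \<in> carrier A" and y: "y \<in> carrier M" "y' \<in> carrier M" for u y y'
  proof -
    obtain r where r: "r \<in> carrier R" "u = r \<odot>\<^bsub>F\<^esub> a" using u by (auto simp: A_simps U_def)
    show ?thesis
      using r y cosetD(2)[of "r \<odot>\<^bsub>M\<^esub> y" "r \<odot>\<^bsub>M\<^esub> y'"] by (simp add: h_a M.smult_r_distr)
  qed
  have h_smult: "h (c \<odot>\<^bsub>M\<^esub> y) u = c \<odot>\<^bsub>quotient_module M W\<^esub> h y u"
    if c: "c \<in> carrier R" and u: "u \<in> carrier A" and y: "y \<in> carrier M" for c u y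
  proof -
    obtain r where r: "r \<in> carrier R" "u = r \<odot>\<^bsub>F\<^esub> a" using u by (auto simp: A_simps U_def)
    have "r \<odot>\<^bsub>M\<^esub> (c \<odot>\<^bsub>M\<^esub> y) = c \<odot>\<^bsub>M\<^esub> (r \<odot>\<^bsub>M\<^esub> y)"
      using r(1) c y by (subst (1 2) M.smult_assoc1[symmetric]) (simp_all add: m_comm)
    then show ?thesis
      using r c y cosetD(3)[of c "r \<odot>\<^bsub>M\<^esub> y"] by (simp add: h_a)
  qed
  obtain \<phi> where \<phi>_unit: "\<And>u y. \<lbrakk>u \<in> carrier A; y \<in> carrier M\<rbrakk> \<Longrightarrow> \<phi> (tensor_unit R A M u y) = h y u"
    and \<phi>_zero: "\<And>f. f \<in> tensor_relations R A M \<Longrightarrow> \<phi> f = \<zero>\<^bsub>quotient_module M W\<^esub>"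
  proof (rule tensor_relations_bilinear[OF A M Q, of "\<lambda>u y. h y u"])
    fix u y assume "u \<in> carrier A" "y \<in> carrier M"
    then show "h y u \<in> carrier (quotient_module M W)" by (intro A.module_homD(1)[OF h])
  next
    fix u u' y assume "u \<in> carrier A" "u' \<in> carrier A" "y \<in> carrier M"
    then show "h y (u \<oplus>\<^bsub>A\<^esub> u') = h y u \<oplus>\<^bsub>quotient_module M W\<^esub> h y u'"
      by (intro A.module_homD(2)[OF h])
  next
    fix r u y assume "r \<in> carrier R" "u \<in> carrier A" "y \<in> carrier M"
    then show "h y (r \<odot>\<^bsub>A\<^esub> u) = r \<odot>\<^bsub>quotient_module M W\<^esub> h y u"
      by (intro A.module_homD(3)[OF h])
  next
    fix \<phi>
    assume "\<And>u y. \<lbrakk>u \<in> carrier A; y \<in> carrier M\<rbrakk> \<Longrightarrow> \<phi> (tensor_unit R A M u y) = h y u"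
      and "\<And>f. f \<in> tensor_relations R A M \<Longrightarrow> \<phi> f = \<zero>\<^bsub>quotient_module M W\<^esub>"
    then show thesis by (rule that)
  qed (rule h_add h_smult; assumption)+
  have "h x a = \<phi> (tensor_unit R A M a x)"
    using \<phi>_unit[of a x] aU xM unfolding A_simps(1) by simp
  also have "\<dots> = W"
    using \<phi>_zero[OF aTA[unfolded TA_def]] by simp
  finally have "h x a = W" .
  then have "W +>\<^bsub>M\<^esub> x = W" using h_a[OF xM one_closed] aF xM by simp
  then have "x \<in> W" using M.coset_eq_zero_iff[OF W xM] by simp
  then show "x \<in> ideal_times R (Ann R J) M" by (simp add: W_def)
qed

section \<open>The submodules gamma and kappa\<close>

text \<open>Direct sums of copies of \<open>I\<close> are killed by \<open>Ann I\<close>, and so are their homomorphic images.\<close>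

lemma (in module) gamma_subset_torsion:
  assumes "ideal I R"
  shows "gamma R I M \<subseteq> torsion M (Ann R I)"
  unfolding gamma_def
proof (rule generated_submodule_least, rule torsion_submodule)
  interpret I: ideal I R by fact
  show "Ann R I \<subseteq> carrier R" by (auto simp: Ann_def)
  show "\<Union>{U. submodule U R M \<and> generated_by R (ideal_module R I) (M\<lparr>carrier := U\<rparr>)} \<subseteq> torsion M (Ann R I)"
  proof (rule Union_least)
    fix U assume "U \<in> {U. submodule U R M \<and> generated_by R (ideal_module R I) (M\<lparr>carrier := U\<rparr>)}"
    then have U: "submodule U R M" and gen: "generated_by R (ideal_module R I) (M\<lparr>carrier := U\<rparr>)"
      by auto
    then obtain \<Lambda> :: "('a \<Rightarrow> 'c) set" and p
      where p: "p \<in> module_hom R (copower_module \<Lambda> (ideal_module R I)) (M\<lparr>carrier := U\<rparr>)"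
        "p ` carrier (copower_module \<Lambda> (ideal_module R I)) = U"
      by (auto simp: generated_by_def)
    let ?C = "copower_module \<Lambda> (ideal_module R I)"
    have C: "module R ?C"
      by (rule module.copower_module_module[OF I.ideal_module_module[OF R.is_cring]])
    interpret C: module R ?C by (rule C)
    have MU: "module R (M\<lparr>carrier := U\<rparr>)"
      using submodule.submodule_is_module[OF U module_axioms] .
    show "U \<subseteq> torsion M (Ann R I)"
    proof
      fix u assume u: "u \<in> U"
      then obtain f where f: "f \<in> carrier ?C" "u = p f" using p(2) by blast
      have "r \<odot>\<^bsub>M\<^esub> u = \<zero>\<^bsub>M\<^esub>" if r: "r \<in> Ann R I" for r
      proof -
        have rR: "r \<in> carrier R" using r by (simp add: Ann_def)
        have "r \<odot>\<^bsub>?C\<^esub> f = \<zero>\<^bsub>?C\<^esub>"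
          using f(1) r by (auto simp: Ann_def fun_eq_iff PiE_iff)
        then have "p (r \<odot>\<^bsub>?C\<^esub> f) = \<zero>\<^bsub>M\<^esub>"
          using module_hom_zero[OF C MU p(1)] by simp
        then show ?thesis using C.module_homD(3)[OF p(1) rR f(1)] f(2) by simp
      qed
      then show "u \<in> torsion M (Ann R I)"
        using u submoduleE(1)[OF U] by (auto simp: torsion_def)
    qed
  qed
qed

text \<open>Every \<open>I x\<close> is an epimorphic image of \<open>I\<close>.  The definition of a generated module indexes the
  copies of \<open>I\<close> by functions; here one copy is enough, and any index will do.\<close>

lemma (in module) ideal_times_subset_gamma:
  assumes "ideal I R"
  shows "ideal_times R I M \<subseteq> gamma R I M"
proof (rule ideal_times_least)
  interpret I: ideal I R by fact
  let ?\<U> = "{U. submodule U R M \<and> generated_by R (ideal_module R I) (M\<lparr>carrier := U\<rparr>)}"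
  have "\<Union>?\<U> \<subseteq> carrier M" using submoduleE(1) by blast
  then show "submodule (gamma R I M) R M"
    unfolding gamma_def by (rule generated_submodule_submodule)
  fix a x assume a: "a \<in> I" and x: "x \<in> carrier M"
  let ?U = "(\<lambda>r. r \<odot>\<^bsub>M\<^esub> x) ` I"
  have U: "submodule ?U R M" by (rule ideal_multiples_submodule) fact+
  let ?l = "undefined :: 'a \<Rightarrow> 'c"
  let ?C = "copower_module {?l} (ideal_module R I)"
  have "(\<lambda>f. f ?l \<odot>\<^bsub>M\<^esub> x) \<in> module_hom R ?C (M\<lparr>carrier := ?U\<rparr>)"
    using x I.a_subset by (auto simp: module_hom_def PiE_iff subset_iff smult_l_distr smult_assoc1)
  moreover have "(\<lambda>f. f ?l \<odot>\<^bsub>M\<^esub> x) ` carrier ?C = ?U"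
  proof
    show "?U \<subseteq> (\<lambda>f. f ?l \<odot>\<^bsub>M\<^esub> x) ` carrier ?C"
    proof
      fix u assume "u \<in> ?U"
      then obtain r where "r \<in> I" "u = r \<odot>\<^bsub>M\<^esub> x" by blast
      then show "u \<in> (\<lambda>f. f ?l \<odot>\<^bsub>M\<^esub> x) ` carrier ?C"
        by (intro image_eqI[of _ _ "\<lambda>l\<in>{?l}. r"]) auto
    qed
  qed auto
  ultimately have "generated_by R (ideal_module R I) (M\<lparr>carrier := ?U\<rparr>)"
    unfolding generated_by_def using submodule.submodule_is_module[OF U module_axioms]
    by (intro conjI exI[of _ "{?l}"] bexI[of _ "\<lambda>f. f ?l \<odot>\<^bsub>M\<^esub> x"]) auto
  then have "?U \<subseteq> gamma R I M"
    unfolding gamma_def using U by (intro order_trans[OF _ generated_submodule_superset]) blast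
  then show "a \<odot>\<^bsub>M\<^esub> x \<in> gamma R I M" using a by blast
qed

lemma Hom_module_simps:
  "carrier (Hom_module R M N) = module_hom R M N \<inter> extensional (carrier M)"
  "f \<oplus>\<^bsub>Hom_module R M N\<^esub> g = (\<lambda>x\<in>carrier M. f x \<oplus>\<^bsub>N\<^esub> g x)"
  "a \<odot>\<^bsub>Hom_module R M N\<^esub> f = (\<lambda>x\<in>carrier M. a \<odot>\<^bsub>N\<^esub> f x)"
  by (auto simp: Hom_module_def)

text \<open>Since \<open>Ann I\<close> kills \<open>Hom(I, E)\<close>, it kills every quotient \<open>M / V\<close> cogenerated by \<open>Hom(I, E)\<close>;
  that is, \<open>(Ann I) M \<subseteq> V\<close>.\<close>

lemma (in module) ideal_times_Ann_subset_kappa: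
  assumes "ideal I R" "module R E"
  shows "ideal_times R (Ann R I) M \<subseteq> kappa R E I M"
  unfolding kappa_def
proof (intro Inter_greatest)
  interpret I: ideal I R by fact
  interpret E: module R E by fact
  let ?D = "Hom_module R (ideal_module R I) E"
  fix V assume "V \<in> {V. submodule V R M \<and> cogenerated_by R ?D (quotient_module M V)}"
  then have V: "submodule V R M" and "cogenerated_by R ?D (quotient_module M V)" by auto
  then obtain \<Lambda> :: "('c set \<Rightarrow> 'a \<Rightarrow> 'e) set" and j
    where j: "j \<in> module_hom R (quotient_module M V) (power_module \<Lambda> ?D)"
      "inj_on j (carrier (quotient_module M V))"
    by (auto simp: cogenerated_by_def)
  interpret Q: module R "quotient_module M V" by (rule quotient_module_module[OF V])
  note coset = module_homD[OF coset_hom[OF V]]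
  show "ideal_times R (Ann R I) M \<subseteq> V"
  proof (rule ideal_times_least[OF V])
    fix r x assume r: "r \<in> Ann R I" and x: "x \<in> carrier M"
    have rR: "r \<in> carrier R" using r by (simp add: Ann_def)
    have ann: "r \<odot>\<^bsub>?D\<^esub> f = (\<lambda>b\<in>I. \<zero>\<^bsub>E\<^esub>)" if f: "f \<in> carrier ?D" for f
    proof -
      have "r \<odot>\<^bsub>E\<^esub> f b = \<zero>\<^bsub>E\<^esub>" if b: "b \<in> I" for b
      proof -
        have f': "f \<in> module_hom R (ideal_module R I) E" using f by (simp add: Hom_module_simps)
        have "r \<odot>\<^bsub>E\<^esub> f b = f (r \<otimes> b)" using f' rR b by (auto simp: module_hom_def)
        also have "r \<otimes> b = \<zero>" using r b by (simp add: Ann_def)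
        also have "f \<zero> = \<zero>\<^bsub>E\<^esub>"
          using module_hom_zero[OF I.ideal_module_module[OF R.is_cring] E.module_axioms f'] by simp
        finally show ?thesis .
      qed
      then show ?thesis by (auto simp: Hom_module_simps fun_eq_iff)
    qed
    have j_ann: "j (r \<odot>\<^bsub>quotient_module M V\<^esub> C) = (\<lambda>l\<in>\<Lambda>. \<lambda>b\<in>I. \<zero>\<^bsub>E\<^esub>)"
      if C: "C \<in> carrier (quotient_module M V)" for C
    proof -
      have "j C \<in> \<Lambda> \<rightarrow>\<^sub>E carrier ?D" using Q.module_homD(1)[OF j(1) C] by simp
      then show ?thesis
        using Q.module_homD(3)[OF j(1) rR C] by (auto simp: fun_eq_iff ann PiE_iff)
    qed
    have 0: "\<zero>\<^bsub>quotient_module M V\<^esub> \<in> carrier (quotient_module M V)" by (rule Q.M.zero_closed)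
    have "r \<odot>\<^bsub>quotient_module M V\<^esub> (V +>\<^bsub>M\<^esub> x) =
        r \<odot>\<^bsub>quotient_module M V\<^esub> \<zero>\<^bsub>quotient_module M V\<^esub>"
      by (rule inj_onD[OF j(2)]) (use j_ann coset(1)[OF x] 0 rR Q.smult_closed in simp_all)
    then have "V +>\<^bsub>M\<^esub> (r \<odot>\<^bsub>M\<^esub> x) = V"
      using Q.smult_r_null[OF rR] quotient_smult[OF V rR x] by simp
    then show "r \<odot>\<^bsub>M\<^esub> x \<in> V" using coset_eq_zero_iff[OF V] rR x by simp
  qed
qed

text \<open>All homomorphisms from \<open>N\<close> to \<open>G\<close> together are the components of the embedding.\<close>

lemma cogenerated_byI:
  assumes "module R N"
    and sep: "\<And>x y. \<lbrakk>x \<in> carrier N; y \<in> carrier N; \<And>h. h \<in> module_hom R N G \<Longrightarrow> h x = h y\<rbrakk> \<Longrightarrow> x = y"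
  shows "cogenerated_by R G N"
proof -
  interpret N: module R N by fact
  let ?\<Lambda> = "module_hom R N G"
  let ?j = "\<lambda>x. \<lambda>h\<in>?\<Lambda>. h x"
  have "?j \<in> module_hom R N (power_module ?\<Lambda> G)"
    unfolding module_hom_def[of R N "power_module ?\<Lambda> G"]
    by (auto simp: N.module_homD fun_eq_iff)
  moreover have "inj_on ?j (carrier N)"
  proof (rule inj_onI)
    fix x y assume x: "x \<in> carrier N" and y: "y \<in> carrier N" and eq: "?j x = ?j y"
    show "x = y"
    proof (rule sep[OF x y])
      fix h assume "h \<in> module_hom R N G"
      then show "h x = h y" using fun_cong[OF eq, of h] by simp
    qed
  qed
  ultimately show ?thesis unfolding cogenerated_by_def using assms(1) by blast
qed

text \<open>It suffices that \<open>M / M[I]\<close> is cogenerated by \<open>Hom(I, E)\<close>.  Every \<open>\<phi> : M \<rightarrow> E\<close> gives a homomorphism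
  \<open>M \<rightarrow> Hom(I, E)\<close>, \<open>y \<mapsto> (b \<mapsto> \<phi>(b y))\<close>, that vanishes on \<open>M[I]\<close>.  If \<open>y\<close> is not in \<open>M[I]\<close>, then
  \<open>b y \<noteq> 0\<close> for some \<open>b \<in> I\<close>, and some \<open>\<phi>\<close> does not vanish on \<open>b y\<close> since \<open>E\<close> is a cogenerator.\<close>

lemma kappa_subset_torsion:
  fixes R :: "('a, 'r) ring_scheme" and E :: "('a, 'e, 'z) module_scheme"
    and M :: "('a, 'm, 'y) module_scheme"
  assumes "noetherian_ring R" "local_ring R \<mm>"
    and hull: "injective_hull R (residue_field_module R \<mm>) E"
    and "ideal I R" and M: "module R M"
  shows "kappa R E I M \<subseteq> torsion M I"
  unfolding kappa_def
proof (rule Inter_lower, intro CollectI conjI)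
  interpret M: module R M by fact
  interpret I: ideal I R by fact
  have E: "module R E" using hull by (auto simp: injective_hull_def injective_module_def)
  interpret E: module R E by (rule E)
  define V where "V = torsion M I"
  have V: "submodule V R M"
    unfolding V_def by (rule M.torsion_submodule[OF I.a_subset])
  then show "submodule (torsion M I) R M" by (simp add: V_def)
  let ?D = "Hom_module R (ideal_module R I) E"
  let ?Q = "quotient_module M V"
  have Q: "module R ?Q" by (rule M.quotient_module_module[OF V])
  interpret Q: module R ?Q by (rule Q)
  have IR: "b \<in> carrier R" if "b \<in> I" for b using that I.a_subset by blast
  have coset: "\<exists>x\<in>carrier M. C = V +>\<^bsub>M\<^esub> x" if "C \<in> carrier ?Q" for C
    using that by (auto simp: A_RCOSETS_def')
  note cosetD = M.module_homD[OF M.coset_hom[OF V]]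
  define rep where "rep C = (SOME x. x \<in> carrier M \<and> C = V +>\<^bsub>M\<^esub> x)" for C
  have rep: "rep C \<in> carrier M" "C = V +>\<^bsub>M\<^esub> rep C" if "C \<in> carrier ?Q" for C
    using someI_ex[of "\<lambda>x. x \<in> carrier M \<and> C = V +>\<^bsub>M\<^esub> x"] coset[OF that]
    unfolding rep_def by blast+
  have rep_smult: "b \<odot>\<^bsub>M\<^esub> rep (V +>\<^bsub>M\<^esub> x) = b \<odot>\<^bsub>M\<^esub> x" if b: "b \<in> I" and x: "x \<in> carrier M" for b x
  proof -
    note r = rep[OF cosetD(1)[OF x]]
    have "rep (V +>\<^bsub>M\<^esub> x) \<ominus>\<^bsub>M\<^esub> x \<in> V"
      using M.coset_eq_iff[OF V r(1) x] r(2) by simp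
    then have "b \<odot>\<^bsub>M\<^esub> (rep (V +>\<^bsub>M\<^esub> x) \<ominus>\<^bsub>M\<^esub> x) = \<zero>\<^bsub>M\<^esub>"
      using b by (simp add: V_def torsion_def)
    then show ?thesis
      using r(1) x IR[OF b]
      by (simp add: a_minus_def M.smult_r_distr M.smult_r_minus M.M.add.inv_solve_right')
  qed
  \<comment> \<open>By the preceding fact, the value does not depend on the chosen representative of the coset.\<close>
  define h where "h \<phi> C = (\<lambda>b\<in>I. \<phi> (b \<odot>\<^bsub>M\<^esub> rep C))" for \<phi> :: "'m \<Rightarrow> 'e" and C
  have h_coset: "h \<phi> (V +>\<^bsub>M\<^esub> x) = (\<lambda>b\<in>I. \<phi> (b \<odot>\<^bsub>M\<^esub> x))" if "x \<in> carrier M" for \<phi> x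
    using that by (auto simp: h_def fun_eq_iff rep_smult)
  have h_hom: "h \<phi> \<in> module_hom R ?Q ?D" if \<phi>: "\<phi> \<in> module_hom R M E" for \<phi>
  proof -
    note \<phi>D = M.module_homD[OF \<phi>]
    show ?thesis
      unfolding module_hom_def
    proof (intro CollectI conjI ballI Pi_I)
      fix C assume "C \<in> carrier ?Q"
      then obtain x where x: "x \<in> carrier M" "C = V +>\<^bsub>M\<^esub> x" using coset by blast
      show "h \<phi> C \<in> carrier ?D"
        using x IR by (auto simp: Hom_module_simps module_hom_def h_coset \<phi>D M.smult_l_distr
            M.smult_assoc1 I.I_l_closed)
    next
      fix C C' assume "C \<in> carrier ?Q" "C' \<in> carrier ?Q"
      then obtain x x' where x: "x \<in> carrier M" "C = V +>\<^bsub>M\<^esub> x" "x' \<in> carrier M" "C' = V +>\<^bsub>M\<^esub> x'"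
        using coset by blast
      show "h \<phi> (C \<oplus>\<^bsub>?Q\<^esub> C') = h \<phi> C \<oplus>\<^bsub>?D\<^esub> h \<phi> C'"
        unfolding x(2,4) cosetD(2)[OF x(1,3), symmetric]
        using x(1,3) IR by (auto simp: Hom_module_simps h_coset \<phi>D M.smult_r_distr)
    next
      fix c C assume c: "c \<in> carrier R" and "C \<in> carrier ?Q"
      then obtain x where x: "x \<in> carrier M" "C = V +>\<^bsub>M\<^esub> x" using coset by blast
      have "b \<odot>\<^bsub>M\<^esub> (c \<odot>\<^bsub>M\<^esub> x) = c \<odot>\<^bsub>M\<^esub> (b \<odot>\<^bsub>M\<^esub> x)" if "b \<in> I" for b
        using c x(1) IR[OF that] by (subst (1 2) M.smult_assoc1[symmetric]) (simp_all add: M.R.m_comm)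
      then show "h \<phi> (c \<odot>\<^bsub>?Q\<^esub> C) = c \<odot>\<^bsub>?D\<^esub> h \<phi> C"
        unfolding x(2) cosetD(3)[OF c x(1), symmetric]
        using c x(1) IR by (auto simp: Hom_module_simps h_coset \<phi>D)
    qed
  qed
  have "cogenerated_by R ?D ?Q"
  proof (rule cogenerated_byI[OF Q], rule ccontr)
    fix C C' assume "C \<in> carrier ?Q" "C' \<in> carrier ?Q" "C \<noteq> C'"
      and eq: "\<And>h. h \<in> module_hom R ?Q ?D \<Longrightarrow> h C = h C'"
    then obtain x x' where x: "x \<in> carrier M" "C = V +>\<^bsub>M\<^esub> x" "x' \<in> carrier M" "C' = V +>\<^bsub>M\<^esub> x'"
      using coset by blast
    have "x \<ominus>\<^bsub>M\<^esub> x' \<notin> V" using \<open>C \<noteq> C'\<close> M.coset_eq_iff[OF V x(1,3)] x(2,4) by simp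
    then obtain b where b: "b \<in> I" "b \<odot>\<^bsub>M\<^esub> (x \<ominus>\<^bsub>M\<^esub> x') \<noteq> \<zero>\<^bsub>M\<^esub>"
      using x by (auto simp: V_def torsion_def)
    have diff: "b \<odot>\<^bsub>M\<^esub> (x \<ominus>\<^bsub>M\<^esub> x') = b \<odot>\<^bsub>M\<^esub> x \<ominus>\<^bsub>M\<^esub> b \<odot>\<^bsub>M\<^esub> x'"
      using x IR[OF b(1)] by (simp add: a_minus_def M.smult_r_distr M.smult_r_minus)
    obtain \<phi> where \<phi>: "\<phi> \<in> module_hom R M E" "\<phi> (b \<odot>\<^bsub>M\<^esub> (x \<ominus>\<^bsub>M\<^esub> x')) \<noteq> \<zero>\<^bsub>E\<^esub>"
      using injective_hull_cogenerator[OF assms(1,2) hull M _ b(2)] x IR[OF b(1)] by auto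
    have "\<phi> (b \<odot>\<^bsub>M\<^esub> x) = \<phi> (b \<odot>\<^bsub>M\<^esub> x')"
      using fun_cong[OF eq[OF h_hom[OF \<phi>(1)]], of b] b(1) x by (simp add: h_coset)
    moreover have "\<phi> (b \<odot>\<^bsub>M\<^esub> (x \<ominus>\<^bsub>M\<^esub> x')) = \<phi> (b \<odot>\<^bsub>M\<^esub> x) \<ominus>\<^bsub>E\<^esub> \<phi> (b \<odot>\<^bsub>M\<^esub> x')"
      unfolding diff by (rule module_hom_minus[OF M E \<phi>(1)]) (use x IR[OF b(1)] in auto)
    ultimately show False
      using \<phi>(2) M.module_homD(1)[OF \<phi>(1)] x IR[OF b(1)] by (simp add: a_minus_def E.M.r_neg)
  qed
  then show "cogenerated_by R ?D (quotient_module M (torsion M I))" by (simp add: V_def)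
qed

theorem mainTheorem11:
  fixes R :: "('a, 'r) ring_scheme"
    and \<mm> I I_bar :: "'a set"
    and E :: "('a, 'e, 'z) module_scheme"
    and M :: "('a, 'm, 'y) module_scheme"
  assumes "noetherian_ring R"
    and "local_ring R \<mm>"
    and "injective_hull R (residue_field_module R \<mm>) E"
    and "ideal I R"
    and "I_bar = Ann R (Ann R I)"
    and "module R M"
  shows "(injective_module R M \<longrightarrow>
            ideal_times R I M = gamma R I M \<and> gamma R I M = torsion M (Ann R I) \<and>
            torsion M I_bar \<subseteq> kappa R E I M \<and> kappa R E I M \<subseteq> torsion M I) \<and>
         (flat_module R M \<longrightarrow>
            ideal_times R (Ann R I) M = kappa R E I M \<and> kappa R E I M = torsion M I \<and>
            ideal_times R I M \<subseteq> gamma R I M \<and> gamma R I M \<subseteq> ideal_times R I_bar M)"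
proof -
  interpret M: module R M by fact
  interpret noetherian_ring R by fact
  have R: "cring R" by (rule M.R.is_cring)
  have E: "module R E"
    using assms(3) by (auto simp: injective_hull_def injective_module_def)
  have AnnI: "ideal (Ann R I) R"
    by (rule M.R.Ann_ideal) (rule additive_subgroup.a_subset[OF ideal.axioms(1)[OF assms(4)]])
  have IM_gamma: "ideal_times R I M \<subseteq> gamma R I M"
    by (rule M.ideal_times_subset_gamma[OF assms(4)])
  have gamma_tors: "gamma R I M \<subseteq> torsion M (Ann R I)"
    by (rule M.gamma_subset_torsion[OF assms(4)])
  have Ann_kappa: "ideal_times R (Ann R I) M \<subseteq> kappa R E I M"
    by (rule M.ideal_times_Ann_subset_kappa[OF assms(4) E])
  have kappa_tors: "kappa R E I M \<subseteq> torsion M I"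
    by (rule kappa_subset_torsion[OF assms(1-4,6)])
  show ?thesis
  proof (intro conjI[of "_ \<longrightarrow> _"] impI)
    assume inj: "injective_module R M"
    have "torsion M (Ann R I) \<subseteq> ideal_times R I M"
      by (rule injective_torsion_subset[OF R inj assms(4)])
    moreover have "torsion M I_bar \<subseteq> ideal_times R (Ann R I) M"
      unfolding assms(5) by (rule injective_torsion_subset[OF R inj AnnI])
    ultimately show "ideal_times R I M = gamma R I M \<and> gamma R I M = torsion M (Ann R I) \<and>
        torsion M I_bar \<subseteq> kappa R E I M \<and> kappa R E I M \<subseteq> torsion M I"
      using IM_gamma gamma_tors Ann_kappa kappa_tors by blast
  next
    assume flat: "flat_module R M"
    have "torsion M I \<subseteq> ideal_times R (Ann R I) M"
      by (rule flat_torsion_subset[OF R flat assms(4)])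
    moreover have "torsion M (Ann R I) \<subseteq> ideal_times R I_bar M"
      unfolding assms(5) by (rule flat_torsion_subset[OF R flat AnnI])
    ultimately show "ideal_times R (Ann R I) M = kappa R E I M \<and> kappa R E I M = torsion M I \<and>
        ideal_times R I M \<subseteq> gamma R I M \<and> gamma R I M \<subseteq> ideal_times R I_bar M"
      using IM_gamma gamma_tors Ann_kappa kappa_tors by blast
  qed
qed

end
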